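(* Let $\eta$ be a random variable taking values in $\{0,1,2,\dots\}\cup\{\infty\}$ with $P(\eta=0)<1$, let $\alpha>0$, and let $p_n=(1-\frac{\alpha}{\log n})^+$, where $x^+=\max\{0,x\}$. (i) If $\alpha>E(\eta)$, then $\lim_{n\to\infty}P(V_\infty(\mathcal{K}_n,p_n)=n)=0$. (ii) If $0<\alpha<E(\eta)$, then $\lim_{n\to\infty}P(V_\infty(\mathcal{K}_n,p_n)=n)=1$ (in particular, if $E(\eta)=\infty$ this holds for every $\alpha>0$).
   Context: Frog model on the complete graph: $\mathcal{K}_n=(\mathcal{V}_n,\mathcal{E}_n)$ is the complete graph on $n$ vertices, with a distinguished vertex $o$ called the root. Let $\{\eta_v\}_{v\in\mathcal{V}_n}$ be i.i.d. copies of $\eta$. Initially each vertex $v\neq o$ carries $\eta_v$ inactive particles and $o$ carries $1+\eta_o$ active particles. At each instant of time, independently of everything else, each active particle survives with probability $p$ and otherwise dies (is permanently removed); a surviving active particle performs one step of simple random walk on $\mathcal{K}_n$ (jumps to a uniformly chosen vertex different from its current one), activating all inactive particles at the vertex it reaches. Inactive particles stay put until activated. A vertex is visited if some active particle is ever at it (the root is visited). $V_\infty(\mathcal{K}_n,p)$ is the total number of visited vertices once no active particles remain; in the cases $P(\eta=\infty)>0$ or $p=1$ one sets $V_\infty(\mathcal{K}_n,p):=n$. *)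

theory Defs
  imports "HOL-Probability.Probability"
begin

text \<open>Frog model on the complete graph K_n with vertex set {0..<n} and root 0.
  Each particle (v,j) (the j-th particle initially at vertex v) carries its own
  i.i.d. randomness S (v,j,t) = (survives step t, jump offset) used at its t-th step
  after activation; a jump from u with offset k in {1..<n} goes to (u + k) mod n,
  i.e. to a uniformly chosen vertex different from u.\<close>

definition frog_step_pmf :: "nat \<Rightarrow> real \<Rightarrow> (bool \<times> nat) pmf" where
  "frog_step_pmf n p = pair_pmf (bernoulli_pmf p) (pmf_of_set {1..<n})"

definition frog_space ::
  "nat \<Rightarrow> real \<Rightarrow> enat pmf \<Rightarrow> ((nat \<Rightarrow> enat) \<times> (nat \<times> nat \<times> nat \<Rightarrow> bool \<times> nat)) measure" where
  "frog_space n p eta =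
     (PiM UNIV (\<lambda>_::nat. measure_pmf eta)) \<Otimes>\<^sub>M
     (PiM UNIV (\<lambda>_::nat \<times> nat \<times> nat. measure_pmf (frog_step_pmf n p)))"

fun particle_pos :: "nat \<Rightarrow> (nat \<times> nat \<times> nat \<Rightarrow> bool \<times> nat) \<Rightarrow> nat \<Rightarrow> nat \<Rightarrow> nat \<Rightarrow> nat" where
  "particle_pos n S v j 0 = v"
| "particle_pos n S v j (Suc t) = (particle_pos n S v j t + snd (S (v, j, t))) mod n"

inductive frog_visited ::
  "nat \<Rightarrow> (nat \<Rightarrow> enat) \<Rightarrow> (nat \<times> nat \<times> nat \<Rightarrow> bool \<times> nat) \<Rightarrow> nat \<Rightarrow> bool"
  for n H S where
  root: "frog_visited n H S 0"
| move: "frog_visited n H S v \<Longrightarrow> enat j < (if v = 0 then 1 else 0) + H v \<Longrightarrow>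
         (\<forall>s<t. fst (S (v, j, s))) \<Longrightarrow> frog_visited n H S (particle_pos n S v j t)"

definition frog_V :: "nat \<Rightarrow> (nat \<Rightarrow> enat) \<Rightarrow> (nat \<times> nat \<times> nat \<Rightarrow> bool \<times> nat) \<Rightarrow> nat" where
  "frog_V n H S = card {v. v < n \<and> frog_visited n H S v}"

text \<open>P(V_infinity(K_n,p) = n), with the convention V := n if P(eta = infinity) > 0 or p = 1.\<close>
definition frog_cover_prob :: "nat \<Rightarrow> real \<Rightarrow> enat pmf \<Rightarrow> real" where
  "frog_cover_prob n p eta =
     (if pmf eta \<infinity> > 0 \<or> p = 1 then 1
      else measure (frog_space n p eta)
             {\<omega> \<in> space (frog_space n p eta). frog_V n (fst \<omega>) (snd \<omega>) = n})"

definition frog_expect :: "enat pmf \<Rightarrow> ennreal" where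
  "frog_expect eta = (\<integral>\<^sup>+ x. ennreal_of_enat x \<partial>measure_pmf eta)"

end

theory Submission
  imports Defs "HOL-Real_Asymp.Real_Asymp"
begin

text \<open>
  Write \<open>c = p / ((1 - p) (n - 1))\<close>, which is asymptotic to \<open>ln n / (\<alpha> n)\<close>. Summing a geometric
  series over the time of the first hit, a particle avoids a set of \<open>k\<close> vertices not containing its
  starting point for its whole life with probability \<open>1 / (1 + k c)\<close>, and distinct particles are
  independent. The initial configuration \<open>H\<close> is fixed (quenched) in the main estimates; it enters only
  through laws of large numbers for the number of particles.

  If \<open>\<alpha> > E \<eta>\<close>, there are at most \<open>\<beta> n\<close> particles with \<open>\<beta> < \<alpha>\<close>. Even if all of them were active, a given
  vertex would be missed with probability about \<open>n powr (- \<beta> / \<alpha>)\<close>, so the expected number of missed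
  vertices diverges; the events are almost uncorrelated and Chebyshev's inequality applies.

  If \<open>\<alpha> < E \<eta>\<close>, truncate \<open>\<eta>\<close> so that its mean still exceeds \<open>\<alpha>\<close>. Using one particle per nonempty vertex,
  an exploration of the random digraph of trails shows that all but a small fraction of the nonempty
  vertices are visited. Then more than \<open>b n\<close> particles with \<open>b > \<alpha>\<close> are activated, none of which meets the
  set of unvisited vertices, and a union bound over that set shows that it is empty.
\<close>

subsection \<open>Independence in i.i.d. families\<close>

text \<open>An elementary substitute for measurability with respect to the coordinates in
  \<open>A\<close>. One implication suffices because \<open>x\<close> and \<open>y\<close> can be
  exchanged.\<close>

definition depends_on :: "'i set \<Rightarrow> ('i \<Rightarrow> 'a) set \<Rightarrow> bool" where
  "depends_on A E \<longleftrightarrow> (\<forall>x y. (\<forall>i\<in>A. x i = y i) \<longrightarrow> x \<in> E \<longrightarrow> y \<in> E)"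

lemma depends_onD: "depends_on A E \<Longrightarrow> (\<And>i. i \<in> A \<Longrightarrow> x i = y i) \<Longrightarrow> x \<in> E \<longleftrightarrow> y \<in> E"
  unfolding depends_on_def by metis

lemma depends_on_INT: "(\<And>k. k \<in> K \<Longrightarrow> depends_on (A k) (E k)) \<Longrightarrow> depends_on (\<Union>k\<in>K. A k) (\<Inter>k\<in>K. E k)"
  unfolding depends_on_def by (smt (verit, best) INT_iff UN_iff)

abbreviation iid_pmf :: "'a pmf \<Rightarrow> ('i \<Rightarrow> 'a) measure" where
  "iid_pmf q \<equiv> PiM UNIV (\<lambda>_. measure_pmf q)"

lemma space_iid_pmf [simp]: "space (iid_pmf q) = UNIV"
  by (simp add: space_PiM)

lemma prob_space_iid_pmf: "prob_space (iid_pmf q)"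
  by (intro prob_space_PiM prob_space_measure_pmf)

lemma iid_pmf_indep_coordinates:
  fixes q :: "'v pmf"
  shows "prob_space.indep_vars (iid_pmf q) (\<lambda>_. measure_pmf q) (\<lambda>i \<omega>. \<omega> i) (UNIV :: 'i set)"
proof -
  interpret prob_space "iid_pmf q :: ('i \<Rightarrow> 'v) measure" by (rule prob_space_iid_pmf)
  show ?thesis
  proof (subst indep_vars_iff_distr_eq_PiM)
    have *: "distr (iid_pmf q) (measure_pmf q) (\<lambda>\<omega>. \<omega> i) = measure_pmf q" for i :: 'i
      by (subst distr_PiM_component) (auto simp: prob_space_measure_pmf)
    show "distr (iid_pmf q) (iid_pmf q) (\<lambda>x. \<lambda>i\<in>UNIV. x i) =
      PiM UNIV (\<lambda>i :: 'i. distr (iid_pmf q) (measure_pmf q) (\<lambda>\<omega>. \<omega> i))"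
      unfolding * by (simp add: restrict_def distr_id2)
  qed auto
qed

lemma measurable_coordinate [measurable]: "(\<lambda>\<omega>. \<omega> i) \<in> iid_pmf q \<rightarrow>\<^sub>M count_space UNIV"
proof -
  have "(\<lambda>\<omega>. \<omega> i) \<in> iid_pmf q \<rightarrow>\<^sub>M measure_pmf q"
    by (rule measurable_component_singleton) simp
  then show ?thesis by (simp cong: measurable_cong_sets)
qed

text \<open>Restrictions of the family to disjoint index sets are independent, and an event
  depending on \<open>A\<close> is the preimage, under restriction to \<open>A\<close>, of an event
  on the smaller product.\<close>

lemma iid_pmf_indep_events:
  fixes q :: "'v pmf" and E F :: "('i \<Rightarrow> 'v) set"
  assumes E: "E \<in> sets (iid_pmf q)" "depends_on A E"
    and F: "F \<in> sets (iid_pmf q)" "depends_on B F" and AB: "A \<inter> B = {}"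
  shows "measure (iid_pmf q) (E \<inter> F) = measure (iid_pmf q) E * measure (iid_pmf q) F"
proof -
  interpret prob_space "iid_pmf q" by (rule prob_space_iid_pmf)
  \<comment> \<open>\<open>ext C\<close> embeds the product over \<open>C\<close> into the full
    product. Pulling an event back along \<open>ext C\<close> and then along restriction recovers it
    if its membership is decided by the coordinates in \<open>C\<close>.\<close>
  define ext where "ext C f = (\<lambda>i. if i \<in> C then f i else undefined)" for C :: "'i set" and f :: "'i \<Rightarrow> 'v"
  have ext: "ext C \<in> PiM C (\<lambda>_. measure_pmf q) \<rightarrow>\<^sub>M iid_pmf q" for C
  proof (rule measurable_PiM_single')
    show "(\<lambda>\<omega>. ext C \<omega> i) \<in> PiM C (\<lambda>_. measure_pmf q) \<rightarrow>\<^sub>M measure_pmf q" for i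
    proof (cases "i \<in> C")
      case True
      then have "(\<lambda>\<omega>. \<omega> i) \<in> PiM C (\<lambda>_. measure_pmf q) \<rightarrow>\<^sub>M measure_pmf q"
        by (rule measurable_component_singleton)
      with True show ?thesis by (simp add: ext_def)
    qed (auto simp: ext_def)
  qed (auto simp: space_PiM)
  have ind: "indep_var (PiM A (\<lambda>_. measure_pmf q)) (\<lambda>\<omega>. restrict \<omega> A)
      (PiM B (\<lambda>_. measure_pmf q)) (\<lambda>\<omega>. restrict \<omega> B)"
    using indep_var_restrict[OF iid_pmf_indep_coordinates AB] by simp
  have vim: "(\<lambda>\<omega>. restrict \<omega> C) -` (ext C -` X \<inter> space (PiM C (\<lambda>_. measure_pmf q))) \<inter> space (iid_pmf q) = X"
    if "depends_on C X" for C X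
  proof -
    have "ext C (restrict \<omega> C) \<in> X \<longleftrightarrow> \<omega> \<in> X" for \<omega>
      by (rule depends_onD[OF that]) (simp add: ext_def)
    then show ?thesis by (auto simp: space_PiM)
  qed
  note pr = indep_varD[OF ind measurable_sets[OF ext E(1)] measurable_sets[OF ext F(1)]]
  have "(\<lambda>x. (restrict x A, restrict x B)) -`
     ((ext A -` E \<inter> space (PiM A (\<lambda>_. measure_pmf q))) \<times> (ext B -` F \<inter> space (PiM B (\<lambda>_. measure_pmf q))))
      \<inter> space (iid_pmf q) = E \<inter> F"
    using vim[OF E(2)] vim[OF F(2)] by auto
  with pr show ?thesis by (simp only: vim[OF E(2)] vim[OF F(2)])
qed

lemma iid_pmf_indep_INT:
  assumes "finite K" "\<And>k. k \<in> K \<Longrightarrow> E k \<in> sets (iid_pmf q)"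
    "\<And>k. k \<in> K \<Longrightarrow> depends_on (A k) (E k)" "disjoint_family_on A K"
  shows "measure (iid_pmf q) (\<Inter>k\<in>K. E k) = (\<Prod>k\<in>K. measure (iid_pmf q) (E k))"
  using assms
proof (induction K)
  case empty
  then show ?case using prob_space.prob_space[OF prob_space_iid_pmf] by simp
next
  case (insert k K)
  have "measure (iid_pmf q) (E k \<inter> (\<Inter>k\<in>K. E k)) =
     measure (iid_pmf q) (E k) * measure (iid_pmf q) (\<Inter>k\<in>K. E k)"
  proof (rule iid_pmf_indep_events)
    show "(\<Inter>k\<in>K. E k) \<in> sets (iid_pmf q)"
      using insert.hyps(1) insert.prems(1)
      by (cases "K = {}") (auto intro!: sets.finite_INT sets.top[of "iid_pmf q", unfolded space_iid_pmf])
    show "depends_on (\<Union>k\<in>K. A k) (\<Inter>k\<in>K. E k)"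
      using insert.prems by (intro depends_on_INT) auto
    show "A k \<inter> (\<Union>k\<in>K. A k) = {}"
      using insert.hyps(2) insert.prems(3) by (auto simp: disjoint_family_on_def)
  qed (use insert.prems in auto)
  with insert show ?case by (simp add: disjoint_family_on_def)
qed

lemma measure_coordinate: "measure (iid_pmf q) {\<omega>. P (\<omega> i)} = measure (measure_pmf q) {x. P x}"
proof -
  have "measure (measure_pmf q) {x. P x} = measure (distr (iid_pmf q) (measure_pmf q) (\<lambda>\<omega>. \<omega> i)) {x. P x}"
    by (subst distr_PiM_component) (auto simp: prob_space_measure_pmf)
  also have "\<dots> = measure (iid_pmf q) {\<omega>. P (\<omega> i)}"
    by (subst measure_distr) (auto intro!: arg_cong2[where f=measure])
  finally show ?thesis by simp
qed

subsection \<open>Trails of particles\<close>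

text \<open>Defined whether or not the particle is ever activated, so that it is a function of the
  particle's own randomness. The starting vertex is included (\<open>t = 0\<close>).\<close>

definition frog_trail :: "nat \<Rightarrow> (nat \<times> nat \<times> nat \<Rightarrow> bool \<times> nat) \<Rightarrow> nat \<times> nat \<Rightarrow> nat set" where
  "frog_trail n S i = {particle_pos n S (fst i) (snd i) t | t. \<forall>s<t. fst (S (fst i, snd i, s))}"

abbreviation steps :: "nat \<Rightarrow> real \<Rightarrow> (nat \<times> nat \<times> nat \<Rightarrow> bool \<times> nat) measure" where
  "steps n p \<equiv> iid_pmf (frog_step_pmf n p)"

lemma measurable_particle_pos [measurable]:
  "(\<lambda>S. particle_pos n S v j t) \<in> iid_pmf q \<rightarrow>\<^sub>M count_space UNIV"
proof (induction t)
  case (Suc t)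
  note Suc [measurable]
  have "(\<lambda>S. (particle_pos n S v j t + snd (S (v, j, t))) mod n) \<in> iid_pmf q \<rightarrow>\<^sub>M count_space UNIV"
    by measurable
  then show ?case by simp
qed simp

lemma particle_pos_cong:
  "(\<And>s. s < t \<Longrightarrow> S (v, j, s) = S' (v, j, s)) \<Longrightarrow> particle_pos n S v j t = particle_pos n S' v j t"
  by (induction t) auto

lemma particle_pos_less: "v < n \<Longrightarrow> particle_pos n S v j t < n"
  by (cases t) auto

lemma frog_trail_subset: "fst i < n \<Longrightarrow> frog_trail n S i \<subseteq> {..<n}"
  by (auto simp: frog_trail_def particle_pos_less)

lemma measurable_mem_frog_trail [measurable]:
  "Measurable.pred (iid_pmf q) (\<lambda>S. u \<in> frog_trail n S i)"
proof -
  have "(\<lambda>S. u \<in> frog_trail n S i) =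
    (\<lambda>S. \<exists>t. particle_pos n S (fst i) (snd i) t = u \<and> (\<forall>s<t. fst (S (fst i, snd i, s))))"
    by (auto simp: frog_trail_def fun_eq_iff)
  then show ?thesis by simp
qed

lemma frog_trail_cong:
  assumes "\<And>s. S (fst i, snd i, s) = S' (fst i, snd i, s)"
  shows "frog_trail n S i = frog_trail n S' i"
  using assms particle_pos_cong[of _ S "fst i" "snd i" S' n] by (simp add: frog_trail_def)

text \<open>Replacing the trails outside \<open>J\<close> by the empty set allows an arbitrary
  predicate \<open>P\<close> on families of trails.\<close>

lemma depends_on_frog_trails:
  "depends_on {k. (fst k, fst (snd k)) \<in> J} {S. P (\<lambda>i. if i \<in> J then frog_trail n S i else {})}"
proof -
  have "(\<lambda>i. if i \<in> J then frog_trail n S i else {}) = (\<lambda>i. if i \<in> J then frog_trail n S' i else {})"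
    if "\<And>k. (fst k, fst (snd k)) \<in> J \<Longrightarrow> S k = S' k" for S S'
    using that by (intro ext) (auto intro!: frog_trail_cong)
  then show ?thesis unfolding depends_on_def
    by (smt (verit) mem_Collect_eq)
qed

section \<open>The law of a single trail\<close>

text \<open>The offsets \<open>1, ..., n - 1\<close>, added to \<open>x\<close> modulo
  \<open>n\<close>, run exactly once through the vertices other than \<open>x\<close>.\<close>

lemma card_jumps_into:
  fixes n x :: nat
  assumes "x < n" "x \<notin> U" "U \<subseteq> {..<n}"
  shows "card {d \<in> {1..<n}. (x + d) mod n \<in> U} = card U"
proof -
  let ?f = "\<lambda>d. (x + d) mod n"
  have eq: "?f d = (if x + d < n then x + d else x + d - n)" if "d < n" for d
    using that assms(1) by (auto simp: mod_if)
  have inj: "inj_on ?f {1..<n}"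
    by (rule inj_onI) (auto simp: eq split: if_splits)
  have sub: "?f ` {1..<n} \<subseteq> {..<n} - {x}"
    using assms(1) by (auto simp: eq split: if_splits)
  have img: "?f ` {1..<n} = {..<n} - {x}"
    by (rule card_subset_eq[OF _ sub]) (use inj assms(1) in \<open>auto simp: card_image\<close>)
  have "?f ` {d \<in> {1..<n}. ?f d \<in> U} = U"
  proof -
    have "?f ` {d \<in> {1..<n}. ?f d \<in> U} = ?f ` {1..<n} \<inter> U" by blast
    then show ?thesis using img assms by auto
  qed
  moreover have "inj_on ?f {d \<in> {1..<n}. ?f d \<in> U}"
    by (rule inj_on_subset[OF inj]) blast
  ultimately show ?thesis
    using card_image by metis
qed

lemma measure_frog_step:
  assumes "n \<ge> 2" "0 \<le> p" "p \<le> 1"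
  shows "measure (frog_step_pmf n p) {y. fst y \<and> snd y \<in> D} = p * card ({1..<n} \<inter> D) / (real n - 1)"
proof -
  have "{y. fst y \<and> snd y \<in> D} = {True} \<times> D" by auto
  moreover have "{1..<n} \<noteq> {}" using assms(1) by simp
  ultimately show ?thesis using assms
    by (simp add: frog_step_pmf_def measure_pmf_prob_product measure_pmf_of_set measure_pmf_single of_nat_diff)
qed

text \<open>From every vertex outside \<open>U\<close> the next step enters \<open>U\<close> with
  the same probability \<open>h\<close>. Hence the first entry occurs at time \<open>t + 1\<close>
  with probability \<open>h * (p - h) ^ t\<close>, whatever the path before it.\<close>

lemma prob_frog_trail_avoids:
  assumes n: "n \<ge> 2" and p: "0 \<le> p" "p < 1" and v: "v < n" "v \<notin> U" and U: "U \<subseteq> {..<n}"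
  shows "measure (steps n p) {S. frog_trail n S (v, j) \<inter> U = {}} =
    1 / (1 + card U * (p / ((1 - p) * (real n - 1))))"
proof -
  interpret prob_space "steps n p" by (rule prob_space_iid_pmf)
  \<comment> \<open>\<open>stay t\<close>: the first \<open>t\<close> steps are survived and the
    positions at times \<open>0\<close> to \<open>t\<close> avoid \<open>U\<close>. Then
    \<open>hit t\<close> is the first entry into \<open>U\<close>, at time
    \<open>t + 1\<close>.\<close>
  define stay where "stay t = {S. (\<forall>s<t. fst (S (v, j, s))) \<and> (\<forall>s\<le>t. particle_pos n S v j s \<notin> U)}" for t
  define hit where "hit t = stay t \<inter> {S. fst (S (v, j, t)) \<and> particle_pos n S v j (Suc t) \<in> U}" for t
  define h where "h = p * card U / (real n - 1)"
  have m[measurable]: "Measurable.pred (steps n p) (\<lambda>S. S \<in> stay t)" for t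
    unfolding stay_def by simp
  have stay_sets [measurable]: "stay t \<in> events" for t
    using m[of t] by (simp add: pred_def)
  have hit_sets [measurable]: "hit t \<in> events" for t
  proof -
    have "Measurable.pred (steps n p) (\<lambda>S. S \<in> hit t)"
      unfolding hit_def by simp
    then show ?thesis by (simp add: pred_def)
  qed
  \<comment> \<open>\<open>stay t\<close> and the position at time \<open>t\<close> are determined
    by the coordinates \<open>(v, j, s)\<close> with \<open>s < t\<close>, hence independent of the
    step used at time \<open>t\<close>.\<close>
  have fresh: "prob (stay t \<inter> {S. particle_pos n S v j t = x} \<inter> {S. Q (S (v, j, t))}) =
      prob (stay t \<inter> {S. particle_pos n S v j t = x}) * measure (frog_step_pmf n p) {y. Q y}" for t x Q
  proof -
    have "prob (stay t \<inter> {S. particle_pos n S v j t = x} \<inter> {S. Q (S (v, j, t))}) =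
      prob (stay t \<inter> {S. particle_pos n S v j t = x}) * prob {S. Q (S (v, j, t))}"
    proof (rule iid_pmf_indep_events)
      have "Measurable.pred (steps n p) (\<lambda>S. S \<in> stay t \<and> particle_pos n S v j t = x)" by simp
      then show "stay t \<inter> {S. particle_pos n S v j t = x} \<in> events"
        by (simp add: pred_def Int_def)
      have "Measurable.pred (steps n p) (\<lambda>S. Q (S (v, j, t)))" by measurable
      then show "{S. Q (S (v, j, t))} \<in> events" by (simp add: pred_def)
      have "particle_pos n S v j s = particle_pos n S' v j s"
        if "\<forall>i\<in>{(v, j, s) | s. s < t}. S i = S' i" "s \<le> t" for S S' s
        using that by (intro particle_pos_cong) auto
      then show "depends_on {(v, j, s) | s. s < t} (stay t \<inter> {S. particle_pos n S v j t = x})"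
        unfolding depends_on_def stay_def
        by (intro allI impI) (simp, metis order_refl nat_less_le)
      show "depends_on {(v, j, t)} {S. Q (S (v, j, t))}"
        by (auto simp: depends_on_def)
    qed auto
    then show ?thesis by (simp add: measure_coordinate)
  qed
  have split: "prob (stay t \<inter> Y) = (\<Sum>x\<in>{..<n} - U. prob (stay t \<inter> {S. particle_pos n S v j t = x} \<inter> Y))"
    if "Y \<in> events" for t Y
  proof -
    have "Measurable.pred (steps n p) (\<lambda>S. S \<in> stay t \<and> particle_pos n S v j t = x)" for x by simp
    then have "stay t \<inter> {S. particle_pos n S v j t = x} \<in> events" for x
      by (simp add: pred_def Int_def)
    then have ev: "stay t \<inter> {S. particle_pos n S v j t = x} \<inter> Y \<in> events" for x
      using that by (rule sets.Int)
    have "stay t \<inter> Y = (\<Union>x\<in>{..<n} - U. stay t \<inter> {S. particle_pos n S v j t = x} \<inter> Y)"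
      using particle_pos_less[OF v(1)] by (auto simp: stay_def)
    also have "prob \<dots> = (\<Sum>x\<in>{..<n} - U. prob (stay t \<inter> {S. particle_pos n S v j t = x} \<inter> Y))"
      using ev by (intro finite_measure_finite_Union) (auto simp: disjoint_family_on_def)
    finally show ?thesis .
  qed
  have hit: "prob (hit t) = h * prob (stay t)" for t
  proof -
    have Y: "{S. fst (S (v, j, t)) \<and> particle_pos n S v j (Suc t) \<in> U} \<in> events"
    proof -
      have "Measurable.pred (steps n p) (\<lambda>S. fst (S (v, j, t)) \<and> particle_pos n S v j (Suc t) \<in> U)"
        by simp
      then show ?thesis by (simp add: pred_def)
    qed
    have "prob (hit t) = (\<Sum>x\<in>{..<n} - U. prob (stay t \<inter> {S. particle_pos n S v j t = x} \<inter>
        {S. fst (S (v, j, t)) \<and> particle_pos n S v j (Suc t) \<in> U}))"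
      unfolding hit_def by (rule split[OF Y])
    also have "\<dots> = (\<Sum>x\<in>{..<n} - U. prob (stay t \<inter> {S. particle_pos n S v j t = x} \<inter>
        {S. fst (S (v, j, t)) \<and> (x + snd (S (v, j, t))) mod n \<in> U}))"
      by (intro sum.cong arg_cong[where f = prob]) auto
    also have "\<dots> = (\<Sum>x\<in>{..<n} - U. prob (stay t \<inter> {S. particle_pos n S v j t = x}) * h)"
    proof (intro sum.cong refl)
      fix x assume x: "x \<in> {..<n} - U"
      have "measure (frog_step_pmf n p) {y. fst y \<and> (x + snd y) mod n \<in> U} = h"
        using measure_frog_step[OF n p(1), of "{d. (x + d) mod n \<in> U}"] p(2) x U card_jumps_into[of x n U]
        by (simp add: h_def Int_def)
      then show "prob (stay t \<inter> {S. particle_pos n S v j t = x} \<inter>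
        {S. fst (S (v, j, t)) \<and> (x + snd (S (v, j, t))) mod n \<in> U}) =
        prob (stay t \<inter> {S. particle_pos n S v j t = x}) * h"
        by (subst fresh[of t x "\<lambda>y. fst y \<and> (x + snd y) mod n \<in> U"]) simp
    qed
    also have "\<dots> = h * (\<Sum>x\<in>{..<n} - U. prob (stay t \<inter> {S. particle_pos n S v j t = x} \<inter> UNIV))"
      by (simp add: sum_distrib_left mult.commute)
    also have "\<dots> = h * prob (stay t)"
      using split[of UNIV t] sets.top[of "steps n p"] by simp
    finally show ?thesis .
  qed
  have surv: "prob (stay t \<inter> {S. fst (S (v, j, t))}) = p * prob (stay t)" for t
  proof -
    have Y: "{S. fst (S (v, j, t))} \<in> events"
    proof -
      have "Measurable.pred (steps n p) (\<lambda>S. fst (S (v, j, t)))" by simp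
      then show ?thesis by (simp add: pred_def)
    qed
    have "measure (frog_step_pmf n p) {y. fst y} = p"
      using measure_frog_step[OF n p(1), of UNIV] n p by simp
    moreover have "prob (stay t \<inter> {S. particle_pos n S v j t = x} \<inter> {S. fst (S (v, j, t))}) =
        prob (stay t \<inter> {S. particle_pos n S v j t = x}) * measure (frog_step_pmf n p) {y. fst y}" for x
      by (rule fresh)
    ultimately have "prob (stay t \<inter> {S. fst (S (v, j, t))}) =
       (\<Sum>x\<in>{..<n} - U. prob (stay t \<inter> {S. particle_pos n S v j t = x} \<inter> UNIV)) * p"
      by (simp add: split[OF Y] sum_distrib_right)
    also have "\<dots> = prob (stay t) * p"
      using split[of UNIV t] sets.top[of "steps n p"] by simp
    finally show ?thesis by simp
  qed
  have stay_Suc: "prob (stay (Suc t)) = (p - h) * prob (stay t)" for t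
  proof -
    have "stay t \<inter> {S. fst (S (v, j, t))} = stay (Suc t) \<union> hit t"
      by (auto simp: stay_def hit_def less_Suc_eq le_Suc_eq)
    moreover have "stay (Suc t) \<inter> hit t = {}"
      by (auto simp: stay_def hit_def)
    ultimately have "p * prob (stay t) = prob (stay (Suc t)) + prob (hit t)"
      by (metis surv finite_measure_Union stay_sets hit_sets)
    then show ?thesis by (simp add: hit algebra_simps)
  qed
  have "stay 0 = UNIV" using v by (auto simp: stay_def)
  then have stay: "prob (stay t) = (p - h) ^ t" for t
    by (induction t) (use prob_space in \<open>auto simp: stay_Suc\<close>)
  have cU: "real (card U) \<le> real n - 1"
  proof -
    have "U \<subseteq> {..<n} - {v}" using v U by auto
    then have "card U \<le> card ({..<n} - {v})" by (intro card_mono) auto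
    then show ?thesis using v n by (simp add: of_nat_diff)
  qed
  have h: "0 \<le> h" "h \<le> p"
    using n p cU by (auto simp: h_def divide_simps mult_left_mono)
  have trail: "{S. frog_trail n S (v, j) \<inter> U \<noteq> {}} = (\<Union>t. hit t)"
  proof (intro equalityI subsetI)
    fix S assume "S \<in> {S. frog_trail n S (v, j) \<inter> U \<noteq> {}}"
    then have ex: "\<exists>t. (\<forall>s<t. fst (S (v, j, s))) \<and> particle_pos n S v j t \<in> U"
      by (auto simp: frog_trail_def)
    define t where "t = (LEAST t. (\<forall>s<t. fst (S (v, j, s))) \<and> particle_pos n S v j t \<in> U)"
    have t: "\<forall>s<t. fst (S (v, j, s))" "particle_pos n S v j t \<in> U"
      using LeastI_ex[OF ex, folded t_def] by blast+
    have min: "particle_pos n S v j s \<notin> U" if "s < t" for s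
    proof -
      have "\<not> ((\<forall>r<s. fst (S (v, j, r))) \<and> particle_pos n S v j s \<in> U)"
        using not_less_Least[OF that[unfolded t_def]] .
      moreover have "\<forall>r<s. fst (S (v, j, r))" using t(1) that less_trans by blast
      ultimately show ?thesis by blast
    qed
    \<comment> \<open>The first entry time is positive because the start \<open>v\<close> lies
      outside \<open>U\<close>.\<close>
    obtain t' where t': "t = Suc t'"
      using t(2) v by (cases t) auto
    have "S \<in> hit t'"
      using t min by (auto simp: hit_def stay_def t' simp del: particle_pos.simps)
    then show "S \<in> (\<Union>t. hit t)" by blast
  next
    fix S assume "S \<in> (\<Union>t. hit t)"
    then obtain t where "S \<in> hit t" by blast
    then have "\<forall>s<Suc t. fst (S (v, j, s))" "particle_pos n S v j (Suc t) \<in> U"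
      by (auto simp: hit_def stay_def less_Suc_eq)
    then have "particle_pos n S v j (Suc t) \<in> frog_trail n S (v, j) \<inter> U"
      unfolding frog_trail_def fst_conv snd_conv by blast
    then show "S \<in> {S. frog_trail n S (v, j) \<inter> U \<noteq> {}}" by blast
  qed
  have disj: "disjoint_family hit"
  proof -
    have "hit s \<inter> hit t = {}" if "s < t" for s t
      using that by (auto simp: hit_def stay_def simp del: particle_pos.simps)
    then show ?thesis unfolding disjoint_family_on_def by (metis Int_commute nat_neq_iff)
  qed
  have "(\<lambda>t. prob (hit t)) sums prob {S. frog_trail n S (v, j) \<inter> U \<noteq> {}}"
    unfolding trail using disj by (intro finite_measure_UNION) auto
  moreover have "(\<lambda>t. prob (hit t)) sums (h * (1 / (1 - (p - h))))"
    unfolding hit stay using h p by (intro sums_mult geometric_sums) auto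
  ultimately have hits: "prob {S. frog_trail n S (v, j) \<inter> U \<noteq> {}} = h / (1 - (p - h))"
    by (simp add: sums_unique2)
  have "{S. frog_trail n S (v, j) \<inter> U = {}} = UNIV - {S. frog_trail n S (v, j) \<inter> U \<noteq> {}}"
    by auto
  then have "prob {S. frog_trail n S (v, j) \<inter> U = {}} = 1 - h / (1 - (p - h))"
    using prob_compl[of "{S. frog_trail n S (v, j) \<inter> U \<noteq> {}}"] trail hits by simp
  also have "\<dots> = (1 - p) / (1 - p + h)"
    using h p by (simp add: field_simps)
  also have "\<dots> = 1 / (1 + h / (1 - p))"
    using h p by (simp add: field_simps)
  also have "h / (1 - p) = card U * (p / ((1 - p) * (real n - 1)))"
    by (simp add: h_def mult_ac)
  finally show ?thesis .
qed

subsection \<open>Visited vertices and particles\<close>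

definition particles :: "nat \<Rightarrow> (nat \<Rightarrow> enat) \<Rightarrow> (nat \<times> nat) set" where
  "particles n H = {(v, j). v < n \<and> enat j < (if v = 0 then 1 else 0) + H v}"

lemma frog_trail_visited:
  assumes "frog_visited n H S v" "(v, j) \<in> particles n H" "u \<in> frog_trail n S (v, j)"
  shows "frog_visited n H S u"
  using assms frog_visited.move[of n H S v j] by (auto simp: frog_trail_def particles_def)

lemma frog_visited_less: "frog_visited n H S v \<Longrightarrow> n > 0 \<Longrightarrow> v < n"
  by (induction rule: frog_visited.induct) (auto simp: particle_pos_less)

text \<open>The complement of \<open>U\<close> contains the root and is closed under following
  trails, so induction on visits never leaves it. This turns non-coverage into a statement about
  trails, without activation times.\<close>

lemma frog_not_visited:
  assumes "0 \<notin> U" "n > 0" "\<And>v j. (v, j) \<in> particles n H \<Longrightarrow> v \<notin> U \<Longrightarrow> frog_trail n S (v, j) \<inter> U = {}"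
    and "frog_visited n H S v"
  shows "v \<notin> U"
  using assms(4)
proof (induction rule: frog_visited.induct)
  case (move v j t)
  have "(v, j) \<in> particles n H"
    using move frog_visited_less[of n H S v] assms(2) by (auto simp: particles_def)
  moreover have "particle_pos n S v j t \<in> frog_trail n S (v, j)"
    using move.hyps by (auto simp: frog_trail_def)
  ultimately show ?case using assms(3) move.IH by blast
qed (fact assms(1))

lemma frog_V_eq_iff: "frog_V n H S = n \<longleftrightarrow> (\<forall>v<n. frog_visited n H S v)"
proof -
  have "frog_V n H S = n \<longleftrightarrow> {v. v < n \<and> frog_visited n H S v} = {..<n}"
    unfolding frog_V_def
    by (metis (mono_tags, lifting) card_lessThan card_subset_eq finite_lessThan lessThan_iff mem_Collect_eq subsetI)
  then show ?thesis by auto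
qed

section \<open>Measurability of the set of visited vertices\<close>

text \<open>Stratifies the inductive predicate by the length of the activation chain, so that each
  level is a countable combination of measurable conditions.\<close>

fun frog_generation :: "nat \<Rightarrow> (nat \<Rightarrow> enat) \<Rightarrow> (nat \<times> nat \<times> nat \<Rightarrow> bool \<times> nat) \<Rightarrow> nat \<Rightarrow> nat \<Rightarrow> bool" where
  "frog_generation n H S 0 v \<longleftrightarrow> v = 0"
| "frog_generation n H S (Suc k) v \<longleftrightarrow> (\<exists>w j t. frog_generation n H S k w \<and>
     enat j < (if w = 0 then 1 else 0) + H w \<and> (\<forall>s<t. fst (S (w, j, s))) \<and> particle_pos n S w j t = v)"

lemma frog_visited_iff_generation: "frog_visited n H S v \<longleftrightarrow> (\<exists>k. frog_generation n H S k v)"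
proof
  assume "frog_visited n H S v"
  then show "\<exists>k. frog_generation n H S k v"
  proof (induction rule: frog_visited.induct)
    case root
    show ?case by (rule exI[of _ 0]) simp
  next
    case (move v j t)
    then obtain k where "frog_generation n H S k v" by blast
    with move.hyps have "frog_generation n H S (Suc k) (particle_pos n S v j t)"
      unfolding frog_generation.simps by blast
    then show ?case by blast
  qed
next
  have "frog_visited n H S v" if "frog_generation n H S k v" for k
    using that by (induction k arbitrary: v) (auto intro: frog_visited.intros)
  then show "\<exists>k. frog_generation n H S k v \<Longrightarrow> frog_visited n H S v" by blast
qed

lemma frog_space_eq: "frog_space n p eta = iid_pmf eta \<Otimes>\<^sub>M steps n p"
  by (simp add: frog_space_def)

lemma measurable_frog_visited [measurable]:
  "Measurable.pred (iid_pmf eta \<Otimes>\<^sub>M iid_pmf q) (\<lambda>\<omega>. frog_visited n (fst \<omega>) (snd \<omega>) v)"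
proof -
  have g: "Measurable.pred (iid_pmf eta \<Otimes>\<^sub>M iid_pmf q) (\<lambda>\<omega>. frog_generation n (fst \<omega>) (snd \<omega>) k v)" for k v
  proof (induction k arbitrary: v)
    case (Suc k)
    have 1: "(\<lambda>\<omega>. particle_pos n (snd \<omega>) w j t)
        \<in> iid_pmf eta \<Otimes>\<^sub>M iid_pmf q \<rightarrow>\<^sub>M count_space UNIV" for w j t
      by (rule measurable_compose[OF measurable_snd measurable_particle_pos])
    have 2 [measurable]: "(\<lambda>\<omega>. snd \<omega> i) \<in> iid_pmf eta \<Otimes>\<^sub>M iid_pmf q \<rightarrow>\<^sub>M count_space UNIV" for i
      by (rule measurable_compose[OF measurable_snd measurable_coordinate])
    have 3: "Measurable.pred (iid_pmf eta \<Otimes>\<^sub>M iid_pmf q) (\<lambda>\<omega>. \<forall>s<t. fst (snd \<omega> (w, j, s)))" for w j t :: nat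
    proof -
      have "Measurable.pred (iid_pmf q) (\<lambda>S. \<forall>s<t. fst (S (w, j, s)))"
        by simp
      from measurable_compose[OF measurable_snd this] show ?thesis .
    qed
    have 4: "Measurable.pred (iid_pmf eta \<Otimes>\<^sub>M iid_pmf q)
        (\<lambda>\<omega>. enat j < (if w = 0 then 1 else 0) + fst \<omega> w)" for j w
      by (rule measurable_compose[OF measurable_compose[OF measurable_fst measurable_coordinate]]) simp
    have 5: "Measurable.pred (iid_pmf eta \<Otimes>\<^sub>M iid_pmf q) (\<lambda>\<omega>. particle_pos n (snd \<omega>) w j t = v)" for w j t
      using 1 by measurable
    show ?case unfolding frog_generation.simps
      by (intro pred_intros_countable pred_intros_logic Suc 3 4 5)
  qed simp
  show ?thesis unfolding frog_visited_iff_generation using g by measurable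
qed

lemma measurable_frog_covered:
  "{\<omega>. frog_V n (fst \<omega>) (snd \<omega>) = n} \<in> sets (iid_pmf eta \<Otimes>\<^sub>M iid_pmf q)"
proof -
  have "Measurable.pred (iid_pmf eta \<Otimes>\<^sub>M iid_pmf q) (\<lambda>\<omega>. \<forall>v<n. frog_visited n (fst \<omega>) (snd \<omega>) v)"
    by measurable
  then show ?thesis by (simp add: pred_def frog_V_eq_iff space_pair_measure)
qed

text \<open>Distinct particles use disjoint coordinates. The avoided set \<open>W i\<close> may vary
  with the particle, since a trail contains its own starting vertex, which has to be
  exempted.\<close>

lemma prob_frog_trails_avoid:
  assumes "n \<ge> 2" "0 \<le> p" "p < 1" "finite I"
    and I: "\<And>i. i \<in> I \<Longrightarrow> fst i < n \<and> fst i \<notin> W i \<and> W i \<subseteq> {..<n}"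
  shows "measure (steps n p) {S. \<forall>i\<in>I. frog_trail n S i \<inter> W i = {}} =
    (\<Prod>i\<in>I. 1 / (1 + card (W i) * (p / ((1 - p) * (real n - 1)))))"
proof -
  have "{S. \<forall>i\<in>I. frog_trail n S i \<inter> W i = {}} = (\<Inter>i\<in>I. {S. frog_trail n S i \<inter> W i = {}})"
    by auto
  also have "measure (steps n p) \<dots> = (\<Prod>i\<in>I. measure (steps n p) {S. frog_trail n S i \<inter> W i = {}})"
  proof (rule iid_pmf_indep_INT)
    fix i assume i: "i \<in> I"
    have "Measurable.pred (steps n p) (\<lambda>S. \<forall>u\<in>W i. u \<notin> frog_trail n S i)"
      by measurable
    moreover have "{S. frog_trail n S i \<inter> W i = {}} = {S. \<forall>u\<in>W i. u \<notin> frog_trail n S i}"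
      by auto
    ultimately show "{S. frog_trail n S i \<inter> W i = {}} \<in> sets (steps n p)"
      by (simp add: pred_def)
    show "depends_on {k. (fst k, fst (snd k)) \<in> {i}} {S. frog_trail n S i \<inter> W i = {}}"
      using depends_on_frog_trails[of "{i}" "\<lambda>R. R i \<inter> W i = {}" n] by simp
  qed (auto simp: disjoint_family_on_def assms(4))
  also have "\<dots> = (\<Prod>i\<in>I. 1 / (1 + card (W i) * (p / ((1 - p) * (real n - 1)))))"
  proof (intro prod.cong refl)
    fix i assume "i \<in> I"
    then show "measure (steps n p) {S. frog_trail n S i \<inter> W i = {}} =
      1 / (1 + card (W i) * (p / ((1 - p) * (real n - 1))))"
      using prob_frog_trail_avoids[OF assms(1-3), of "fst i" "W i" "snd i"] I by simp
  qed
  finally show ?thesis .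
qed

subsection \<open>Few particles: second moment\<close>

text \<open>Chebyshev's inequality for the number \<open>N\<close> of events \<open>A u\<close> that
  occur. With \<open>e\<close> the mean of \<open>N\<close>, the correlation bound gives variance at
  most \<open>e + \<delta> * e\<^sup>2\<close>; outside the union \<open>N\<close> is
  \<open>0\<close> and deviates from its mean by \<open>e\<close>.\<close>

lemma (in prob_space) second_moment_bound:
  assumes fin: "finite U" and A: "\<And>u. u \<in> U \<Longrightarrow> A u \<in> events"
    and corr: "\<And>u w. u \<in> U \<Longrightarrow> w \<in> U \<Longrightarrow> u \<noteq> w \<Longrightarrow> prob (A u \<inter> A w) \<le> (1 + \<delta>) * prob (A u) * prob (A w)"
    and m: "0 < m" "m \<le> (\<Sum>u\<in>U. prob (A u))" and \<delta>: "0 \<le> \<delta>"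
  shows "prob (space M - (\<Union>u\<in>U. A u)) \<le> 1 / m + \<delta>"
proof -
  define N where "N \<omega> = (\<Sum>u\<in>U. indicator (A u) \<omega> :: real)" for \<omega>
  define e where "e = (\<Sum>u\<in>U. prob (A u))"
  note A [measurable]
  have int: "integrable M (indicator (A u) :: 'a \<Rightarrow> real)" if "u \<in> U" for u
    using A[OF that] by (simp add: integrable_indicator_iff emeasure_eq_measure)
  have EN: "expectation N = e"
    unfolding N_def e_def using int by (simp add: A)
  have sq: "(N \<omega>)\<^sup>2 = (\<Sum>u\<in>U. \<Sum>w\<in>U. indicator (A u \<inter> A w) \<omega>)" for \<omega>
    by (simp add: N_def power2_eq_square sum_product indicator_inter_arith)
  have int2: "integrable M (indicator (A u \<inter> A w) :: 'a \<Rightarrow> real)" if "u \<in> U" "w \<in> U" for u w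
    using A[OF that(1)] A[OF that(2)] by (simp add: integrable_indicator_iff emeasure_eq_measure)
  have iN: "integrable M N" unfolding N_def using int by simp
  have iN2: "integrable M (\<lambda>\<omega>. (N \<omega>)\<^sup>2)" unfolding sq using int2 by simp
  have "expectation (\<lambda>\<omega>. (N \<omega>)\<^sup>2) = (\<Sum>u\<in>U. \<Sum>w\<in>U. prob (A u \<inter> A w))"
    unfolding sq using int2 by (simp add: A)
  \<comment> \<open>On the diagonal the intersection is \<open>A u\<close> itself; the product terms
    added there are nonnegative.\<close>
  also have "\<dots> \<le> (\<Sum>u\<in>U. \<Sum>w\<in>U. (if w = u then prob (A u) else 0) + (1 + \<delta>) * prob (A u) * prob (A w))"
  proof (intro sum_mono)
    fix u w assume "u \<in> U" "w \<in> U"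
    then show "prob (A u \<inter> A w) \<le> (if w = u then prob (A u) else 0) + (1 + \<delta>) * prob (A u) * prob (A w)"
      using corr[of u w] \<delta> by auto
  qed
  also have "\<dots> = e + (1 + \<delta>) * e\<^sup>2"
  proof -
    have "(\<Sum>u\<in>U. \<Sum>w\<in>U. (1 + \<delta>) * prob (A u) * prob (A w)) = (1 + \<delta>) * e\<^sup>2"
      unfolding e_def power2_eq_square sum_product by (simp add: sum_distrib_left mult.assoc)
    then show ?thesis by (simp add: sum.distrib fin e_def)
  qed
  finally have var: "variance N \<le> e + \<delta> * e\<^sup>2"
    by (subst variance_eq[OF iN iN2], subst EN) (simp add: algebra_simps)
  have e: "e > 0" "m \<le> e" using m by (auto simp: e_def)
  have "prob (space M - (\<Union>u\<in>U. A u)) \<le> prob {\<omega> \<in> space M. e \<le> \<bar>N \<omega> - expectation N\<bar>}"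
    using iN by (intro finite_measure_mono) (auto simp: EN N_def indicator_def)
  also have "\<dots> \<le> variance N / e\<^sup>2"
    using iN iN2 e by (intro Chebyshev_inequality) auto
  also have "\<dots> \<le> (e + \<delta> * e\<^sup>2) / e\<^sup>2"
    by (intro divide_right_mono var) simp
  also have "\<dots> = 1 / e + \<delta>" using e by (simp add: field_simps power2_eq_square)
  also have "\<dots> \<le> 1 / m + \<delta>" using e m by (simp add: frac_le)
  finally show ?thesis .
qed

text \<open>\<open>A u\<close> says that no particle starting elsewhere meets \<open>u\<close> even
  if all are active, so \<open>u\<close> stays unvisited when it is not the root. Its probability is
  at least \<open>exp (- c * N)\<close> by \<open>1 + c \<le> exp c\<close>, and each particle adds
  at most a factor \<open>exp (c\<^sup>2)\<close> to the correlation of two such events.\<close>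

lemma quenched_not_covered:
  assumes n: "n \<ge> 2" and p: "0 \<le> p" "p < 1" and I: "finite (particles n H)"
    and N: "real (card (particles n H)) \<le> N"
  defines "c \<equiv> p / ((1 - p) * (real n - 1))"
  shows "measure (steps n p) {S. frog_V n H S = n}
    \<le> 1 / ((real n - 1) * exp (- c * N)) + (exp (c\<^sup>2 * N) - 1)"
proof -
  interpret prob_space "steps n p" by (rule prob_space_iid_pmf)
  let ?I = "particles n H"
  have c: "c \<ge> 0" using n p by (auto simp: c_def)
  \<comment> \<open>A particle starting at a vertex \<open>u\<close> other than the root has
    \<open>u\<close> on its trail but cannot be the first to visit it; removing \<open>fst i\<close>
    from the target exempts it.\<close>
  define A where "A u = {S. \<forall>i\<in>?I. frog_trail n S i \<inter> ({u} - {fst i}) = {}}" for u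
  define a where "a u = (\<Prod>i\<in>?I. 1 / (1 + card ({u} - {fst i}) * c))" for u
  have a0: "0 \<le> a u" for u
    unfolding a_def using c by (intro prod_nonneg) simp
  have vI: "fst i < n" if "i \<in> ?I" for i using that by (auto simp: particles_def)
  have A_sets: "A u \<in> events" for u
  proof -
    have "Measurable.pred (steps n p) (\<lambda>S. \<forall>i\<in>?I. \<forall>w\<in>{u} - {fst i}. w \<notin> frog_trail n S i)"
      using I by measurable
    moreover have "A u = {S. \<forall>i\<in>?I. \<forall>w\<in>{u} - {fst i}. w \<notin> frog_trail n S i}"
      unfolding A_def by blast
    ultimately show ?thesis by (simp add: pred_def)
  qed
  have PA: "prob (A u) = a u" if "u < n" for u
    unfolding A_def a_def c_def using vI that
    by (intro prob_frog_trails_avoid n p I) auto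
  have PAA: "prob (A u \<inter> A w) \<le> (1 + (exp (c\<^sup>2 * N) - 1)) * prob (A u) * prob (A w)"
    if "u < n" "w < n" "u \<noteq> w" for u w
  proof -
    have "A u \<inter> A w = {S. \<forall>i\<in>?I. frog_trail n S i \<inter> ({u, w} - {fst i}) = {}}"
      by (auto simp: A_def)
    then have "prob (A u \<inter> A w) = (\<Prod>i\<in>?I. 1 / (1 + card ({u, w} - {fst i}) * c))"
      unfolding c_def using vI that by (simp only:, intro prob_frog_trails_avoid n p I) auto
    also have "\<dots> \<le> (\<Prod>i\<in>?I. exp (c\<^sup>2) * (1 / (1 + card ({u} - {fst i}) * c)) *
        (1 / (1 + card ({w} - {fst i}) * c)))"
    proof (intro prod_mono conjI)
      fix i
      have e: "1 + c\<^sup>2 \<le> exp (c\<^sup>2)" by (rule exp_ge_add_one_self)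
      have e1: "1 \<le> exp (c\<^sup>2)" by simp
      show "0 \<le> 1 / (1 + card ({u, w} - {fst i}) * c)" using c by simp
      \<comment> \<open>A particle starting at \<open>u\<close> or \<open>w\<close> has only the
        other vertex to avoid. Otherwise \<open>(1 + c)\<^sup>2\<close> has to be compared with
        \<open>1 + 2 * c\<close>.\<close>
      consider "fst i = u" | "fst i = w" | "fst i \<noteq> u" "fst i \<noteq> w" by blast
      then show "1 / (1 + card ({u, w} - {fst i}) * c) \<le> exp (c\<^sup>2) * (1 / (1 + card ({u} - {fst i}) * c)) *
        (1 / (1 + card ({w} - {fst i}) * c))"
      proof cases
        case 1
        then have "{u, w} - {fst i} = {w}" "{u} - {fst i} = {}" "{w} - {fst i} = {w}"
          using \<open>u \<noteq> w\<close> by auto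
        then show ?thesis using c e1 by (simp add: divide_right_mono)
      next
        case 2
        then have "{u, w} - {fst i} = {u}" "{u} - {fst i} = {u}" "{w} - {fst i} = {}"
          using \<open>u \<noteq> w\<close> by auto
        then show ?thesis using c e1 by (simp add: divide_right_mono)
      next
        case 3
        then have "{u, w} - {fst i} = {u, w}" "{u} - {fst i} = {u}" "{w} - {fst i} = {w}"
          by auto
        then have *: "card ({u, w} - {fst i}) = 2" "card ({u} - {fst i}) = 1" "card ({w} - {fst i}) = 1"
          using \<open>u \<noteq> w\<close> by auto
        have "(1 + c) * (1 + c) \<le> (1 + c\<^sup>2) * (1 + 2 * c)"
          using c by (simp add: algebra_simps power2_eq_square)
        also have "\<dots> \<le> exp (c\<^sup>2) * (1 + 2 * c)"
          using e c by (intro mult_right_mono) auto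
        finally show ?thesis unfolding * using c by (simp add: divide_simps)
      qed
    qed
    also have "\<dots> = exp (c\<^sup>2) ^ card ?I * a u * a w"
      unfolding a_def prod.distrib by simp
    also have "exp (c\<^sup>2) ^ card ?I = exp (card ?I * c\<^sup>2)"
      by (rule exp_of_nat_mult[symmetric])
    also have "\<dots> * a u * a w \<le> exp (c\<^sup>2 * N) * a u * a w"
      using mult_left_mono[OF N, of "c\<^sup>2"] a0 by (intro mult_right_mono) (simp_all add: mult.commute)
    finally show ?thesis using PA that by simp
  qed
  have "exp (- c * N) \<le> prob (A u)" if "u < n" for u
  proof -
    have "exp (- c * N) \<le> exp (card ?I * (- c))"
      using mult_left_mono[OF N c] by (simp add: mult.commute)
    also have "\<dots> = (\<Prod>i\<in>?I. exp (- c))"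
      unfolding exp_of_nat_mult by simp
    also have "\<dots> \<le> a u"
      unfolding a_def
    proof (intro prod_mono conjI)
      fix i
      have "card ({u} - {fst i}) \<le> 1"
        using card_mono[of "{u}" "{u} - {fst i}"] by simp
      then have "1 + card ({u} - {fst i}) * c \<le> 1 + c"
        using c mult_right_mono[of "real (card ({u} - {fst i}))" 1 c] by simp
      also have "\<dots> \<le> exp c" by (rule exp_ge_add_one_self)
      finally have "1 / exp c \<le> 1 / (1 + card ({u} - {fst i}) * c)"
        using c by (intro divide_left_mono mult_pos_pos add_pos_nonneg mult_nonneg_nonneg) auto
      then show "exp (- c) \<le> 1 / (1 + card ({u} - {fst i}) * c)"
        by (simp add: exp_minus inverse_eq_divide)
    qed simp
    finally show ?thesis using PA that by simp
  qed
  then have "(\<Sum>u\<in>{1..<n}. exp (- c * N)) \<le> (\<Sum>u\<in>{1..<n}. prob (A u))"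
    by (intro sum_mono) simp
  then have m: "(real n - 1) * exp (- c * N) \<le> (\<Sum>u\<in>{1..<n}. prob (A u))"
    using n by (simp add: of_nat_diff)
  \<comment> \<open>The root is always visited and is therefore left out of the union, which
    explains the factor \<open>n - 1\<close>.\<close>
  have "{S. frog_V n H S = n} \<subseteq> space (steps n p) - (\<Union>u\<in>{1..<n}. A u)"
  proof
    fix S assume S: "S \<in> {S. frog_V n H S = n}"
    have "S \<notin> A u" if u: "u \<in> {1..<n}" for u
    proof
      assume "S \<in> A u"
      then have "u \<notin> {u}"
        using S u by (intro frog_not_visited[of "{u}" n H S u]) (auto simp: A_def frog_V_eq_iff)
      then show False by simp
    qed
    then show "S \<in> space (steps n p) - (\<Union>u\<in>{1..<n}. A u)" by auto
  qed
  then have "prob {S. frog_V n H S = n} \<le> prob (space (steps n p) - (\<Union>u\<in>{1..<n}. A u))"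
    using A_sets by (intro finite_measure_mono sets.Diff sets.finite_UN sets.top) auto
  also have "\<dots> \<le> 1 / ((real n - 1) * exp (- c * N)) + (exp (c\<^sup>2 * N) - 1)"
  proof (rule second_moment_bound)
    have "0 \<le> N" using N by (rule order_trans[OF of_nat_0_le_iff])
    then show "0 \<le> exp (c\<^sup>2 * N) - 1" by simp
    show "0 < (real n - 1) * exp (- c * N)" using n by simp
    show "(real n - 1) * exp (- c * N) \<le> (\<Sum>u\<in>{1..<n}. prob (A u))" by (rule m)
    show "prob (A u \<inter> A w) \<le> (1 + (exp (c\<^sup>2 * N) - 1)) * prob (A u) * prob (A w)"
      if "u \<in> {1..<n}" "w \<in> {1..<n}" "u \<noteq> w" for u w
      using that by (intro PAA) auto
  qed (use A_sets in auto)
  finally show ?thesis .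
qed

subsection \<open>Many particles: exploration and union bound\<close>

lemma sum_Pow_by_card:
  fixes g :: "nat \<Rightarrow> real"
  assumes "finite A"
  shows "(\<Sum>U\<in>Pow A. g (card U)) = (\<Sum>m\<le>card A. real (card A choose m) * g m)"
proof -
  have "(\<Sum>U\<in>Pow A. g (card U)) = (\<Sum>m\<le>card A. \<Sum>U\<in>{U \<in> Pow A. card U = m}. g (card U))"
    using assms by (intro sum.group[symmetric]) (auto simp: card_mono)
  also have "\<dots> = (\<Sum>m\<le>card A. real (card A choose m) * g m)"
    using n_subsets[OF assms] by (intro sum.cong) (auto simp: Pow_def)
  finally show ?thesis .
qed

text \<open>Particle \<open>0\<close> of each vertex suffices here. For \<open>A\<close> the unexplored vertices and \<open>X\<close> those of them
  already found, some closed set \<open>C\<close> of discoveries leaves out at least \<open>M\<close> vertices.\<close>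

definition confined :: "nat \<Rightarrow> nat \<Rightarrow> nat set \<Rightarrow> nat set \<Rightarrow> (nat \<times> nat \<Rightarrow> nat set) \<Rightarrow> bool" where
  "confined n M A X R \<longleftrightarrow> (\<exists>C\<in>Pow A. X \<subseteq> C \<and> (\<forall>w\<in>C. \<forall>u\<in>A. u \<in> R (w, 0) \<longrightarrow> u \<in> C) \<and> M \<le> card (A - C))"

lemma confined_sets:
  assumes "finite A"
  shows "{S. confined n M A X (frog_trail n S)} \<in> sets (steps n p)"
proof -
  have "Measurable.pred (steps n p) (\<lambda>S. \<exists>C\<in>Pow A. X \<subseteq> C \<and>
     (\<forall>w\<in>C. \<forall>u\<in>A. u \<in> frog_trail n S (w, 0) \<longrightarrow> u \<in> C) \<and> M \<le> card (A - C))"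
    using assms by (intro pred_intros_finite pred_intros_logic) (auto intro: finite_subset)
  then show ?thesis by (simp add: pred_def confined_def)
qed

text \<open>Closed sets lie inside \<open>A\<close>, so only trails \<open>(w, 0)\<close> with
  \<open>w \<in> A\<close> are inspected. The remaining exploration is thus independent of the trail
  of a vertex already removed from \<open>A\<close>.\<close>

lemma confined_depends_on:
  "depends_on {k. (fst k, fst (snd k)) \<in> A \<times> {0}} {S. confined n M A X (frog_trail n S)}"
proof -
  have "confined n M A X (frog_trail n S) =
    confined n M A X (\<lambda>i. if i \<in> A \<times> {0} then frog_trail n S i else {})" for S
    unfolding confined_def by (intro bex_cong refl) auto
  then show ?thesis using depends_on_frog_trails[of "A \<times> {0}" "confined n M A X" n] by simp
qed

text \<open>One exploration step: \<open>w\<close> leaves both \<open>A\<close> and the closed set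
  \<open>C\<close>, and the part of its trail in \<open>A - X\<close> joins the found vertices. The
  left-out set \<open>A - C\<close> is unchanged, so the threshold \<open>M\<close> is kept.\<close>

lemma confined_explore:
  assumes "confined n M A X R" "w \<in> X" "finite A"
  shows "confined n M (A - {w}) ((X - {w}) \<union> (R (w, 0) \<inter> (A - X))) R"
proof -
  obtain C where C: "C \<subseteq> A" "X \<subseteq> C" "\<forall>w\<in>C. \<forall>u\<in>A. u \<in> R (w, 0) \<longrightarrow> u \<in> C" "M \<le> card (A - C)"
    using assms(1) by (auto simp: confined_def)
  moreover have "A - {w} - (C - {w}) = A - C" using C assms(2) by auto
  ultimately show ?thesis
    unfolding confined_def using assms(2) by (intro bexI[of _ "C - {w}"]) auto
qed

lemma confined_card_le:
  assumes "confined n M A X R" "finite A"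
  shows "M \<le> card (A - X)"
proof -
  obtain C where "X \<subseteq> C" "M \<le> card (A - C)"
    using assms(1) unfolding confined_def by (elim bexE conjE)
  moreover have "card (A - C) \<le> card (A - X)"
    using \<open>X \<subseteq> C\<close> assms(2) by (intro card_mono) auto
  ultimately show ?thesis by linarith
qed

lemma frog_trail_eq_sets:
  assumes "fst i < n" "r \<subseteq> {..<n}"
  shows "{S. frog_trail n S i = r} \<in> sets (steps n p)"
proof -
  have "Measurable.pred (steps n p) (\<lambda>S. \<forall>u\<in>{..<n}. u \<in> frog_trail n S i \<longleftrightarrow> u \<in> r)"
    by measurable
  moreover have "frog_trail n S i = r \<longleftrightarrow> (\<forall>u\<in>{..<n}. u \<in> frog_trail n S i \<longleftrightarrow> u \<in> r)" for S
    using assms(2) frog_trail_subset[OF assms(1), of S] by blast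
  ultimately show ?thesis by (simp add: pred_def)
qed

lemma sum_prob_frog_trail:
  assumes "fst i < n"
  shows "(\<Sum>r\<in>Pow {..<n}. measure (steps n p) {S. frog_trail n S i = r} * of_bool (Q r)) =
    measure (steps n p) {S. Q (frog_trail n S i)}"
proof -
  interpret prob_space "steps n p" by (rule prob_space_iid_pmf)
  have "{S. Q (frog_trail n S i)} = (\<Union>r\<in>{r \<in> Pow {..<n}. Q r}. {S. frog_trail n S i = r})"
    using frog_trail_subset[OF assms] by auto
  also have "prob \<dots> = (\<Sum>r\<in>{r \<in> Pow {..<n}. Q r}. prob {S. frog_trail n S i = r})"
    using assms by (intro finite_measure_finite_Union)
      (auto simp: disjoint_family_on_def intro!: frog_trail_eq_sets)
  also have "\<dots> = (\<Sum>r\<in>Pow {..<n}. prob {S. frog_trail n S i = r} * of_bool (Q r))"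
    by (intro sum.mono_neutral_cong_left) auto
  finally show ?thesis ..
qed

text \<open>The weight \<open>l ^ (number of found but unexplored vertices)\<close> is a supermartingale of the
  exploration as long as at least \<open>M\<close> vertices have not been found.\<close>

lemma prob_confined_le:
  assumes l: "0 \<le> l"
    and step: "\<And>w U. w < n \<Longrightarrow> U \<subseteq> {..<n} \<Longrightarrow> w \<notin> U \<Longrightarrow> M \<le> card U \<Longrightarrow>
      (\<Sum>r\<in>Pow {..<n}. measure (steps n p) {S. frog_trail n S (w, 0) = r} * l ^ card (r \<inter> U)) \<le> l"
    and "A \<subseteq> {..<n}" "X \<subseteq> A"
  shows "measure (steps n p) {S. confined n M A X (frog_trail n S)} \<le> l ^ card X"
proof -
  interpret prob_space "steps n p" by (rule prob_space_iid_pmf)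
  have "finite A" using assms(3) finite_subset by blast
  then show ?thesis using assms(3,4)
  proof (induction arbitrary: X rule: finite_remove_induct)
    case empty
    then show ?case by simp
  next
    case (remove A)
    note finA = remove.hyps(1)
    show ?case
    \<comment> \<open>The exploration stops when no found vertex remains to be explored, where the
      bound is \<open>1\<close>, or when fewer than \<open>M\<close> vertices are unfound, where the
      event is empty.\<close>
    proof (cases "X = {} \<or> card (A - X) < M")
      case True
      then show ?thesis
      proof
        assume "card (A - X) < M"
        then have "\<not> confined n M A X R" for R
          using confined_card_le[OF _ finA, of n M X R] by linarith
        then have "{S. confined n M A X (frog_trail n S)} = {}" by simp
        then show ?thesis using l by simp
      qed simp
    next
      case False
      then obtain w where w: "w \<in> X" by blast
      have wn: "w < n" using subsetD[OF remove.prems(2) w] remove.prems(1) by blast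
      have finX: "finite X" using remove.prems(2) finA finite_subset by blast
      \<comment> \<open>The found but unexplored vertices after exploring \<open>w\<close>, if its
        trail is \<open>r\<close>.\<close>
      define Y where "Y r = (X - {w}) \<union> (r \<inter> (A - X))" for r
      have "{S. confined n M A X (frog_trail n S)} \<subseteq>
        (\<Union>r\<in>Pow {..<n}. {S. frog_trail n S (w, 0) = r} \<inter> {S. confined n M (A - {w}) (Y r) (frog_trail n S)})"
      proof
        fix S assume "S \<in> {S. confined n M A X (frog_trail n S)}"
        then have "confined n M (A - {w}) (Y (frog_trail n S (w, 0))) (frog_trail n S)"
          unfolding Y_def using confined_explore[OF _ w finA] by blast
        moreover have "frog_trail n S (w, 0) \<in> Pow {..<n}"
          using frog_trail_subset[of "(w, 0)" n S] wn by simp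
        ultimately show "S \<in> (\<Union>r\<in>Pow {..<n}. {S. frog_trail n S (w, 0) = r} \<inter>
            {S. confined n M (A - {w}) (Y r) (frog_trail n S)})"
          by blast
      qed
      then have "prob {S. confined n M A X (frog_trail n S)} \<le> prob
        (\<Union>r\<in>Pow {..<n}. {S. frog_trail n S (w, 0) = r} \<inter> {S. confined n M (A - {w}) (Y r) (frog_trail n S)})"
        using wn finA by (intro finite_measure_mono sets.finite_UN sets.Int frog_trail_eq_sets confined_sets) auto
      also have "\<dots> \<le> (\<Sum>r\<in>Pow {..<n}. prob ({S. frog_trail n S (w, 0) = r} \<inter>
          {S. confined n M (A - {w}) (Y r) (frog_trail n S)}))"
        using wn finA by (intro finite_measure_subadditive_finite image_subsetI sets.Int frog_trail_eq_sets confined_sets) auto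
      also have "\<dots> \<le> (\<Sum>r\<in>Pow {..<n}. prob {S. frog_trail n S (w, 0) = r} * (l ^ (card X - 1) * l ^ card (r \<inter> (A - X))))"
      proof (intro sum_mono)
        fix r assume r: "r \<in> Pow {..<n}"
        have "prob ({S. frog_trail n S (w, 0) = r} \<inter> {S. confined n M (A - {w}) (Y r) (frog_trail n S)}) =
          prob {S. frog_trail n S (w, 0) = r} * prob {S. confined n M (A - {w}) (Y r) (frog_trail n S)}"
        proof (rule iid_pmf_indep_events)
          show "depends_on {k. (fst k, fst (snd k)) \<in> {(w, 0)}} {S. frog_trail n S (w, 0) = r}"
            using depends_on_frog_trails[of "{(w, 0)}" "\<lambda>R. R (w, 0) = r" n] by simp
          show "depends_on {k. (fst k, fst (snd k)) \<in> (A - {w}) \<times> {0}} {S. confined n M (A - {w}) (Y r) (frog_trail n S)}"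
            by (rule confined_depends_on)
        qed (use r wn finA in \<open>auto intro!: frog_trail_eq_sets confined_sets\<close>)
        also have "\<dots> \<le> prob {S. frog_trail n S (w, 0) = r} * l ^ card (Y r)"
          using w remove.prems by (intro mult_left_mono remove.IH) (auto simp: Y_def)
        also have "card (Y r) = (card X - 1) + card (r \<inter> (A - X))"
          unfolding Y_def using finX finA w by (subst card_Un_disjoint) auto
        finally show "prob ({S. frog_trail n S (w, 0) = r} \<inter> {S. confined n M (A - {w}) (Y r) (frog_trail n S)})
          \<le> prob {S. frog_trail n S (w, 0) = r} * (l ^ (card X - 1) * l ^ card (r \<inter> (A - X)))"
          by (simp add: power_add)
      qed
      also have "\<dots> = l ^ (card X - 1) * (\<Sum>r\<in>Pow {..<n}. prob {S. frog_trail n S (w, 0) = r} * l ^ card (r \<inter> (A - X)))"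
        by (simp add: sum_distrib_left mult_ac)
      \<comment> \<open>\<open>step\<close> applies to \<open>U = A - X\<close>, which has at least
        \<open>M\<close> elements by the case distinction and does not contain \<open>w\<close>. The
        factor \<open>l\<close> makes up for the removal of \<open>w\<close> from
        \<open>X\<close>.\<close>
      also have "\<dots> \<le> l ^ (card X - 1) * l"
        using False remove.prems l w by (intro mult_left_mono step[OF wn]) auto
      also have "\<dots> = l ^ card X"
        using w finX by (metis card_Suc_Diff1 card_Diff_singleton power_Suc2)
      finally show ?thesis .
    qed
  qed
qed

text \<open>A trail meeting at most one element of \<open>U\<close> avoids one of two disjoint halves of \<open>U\<close>.\<close>

lemma frog_trail_generating_function_le:
  fixes M :: nat
  assumes n: "n \<ge> 2" and p: "0 \<le> p" "p < 1" and w: "w < n" "w \<notin> U" and U: "U \<subseteq> {..<n}" "M \<le> card U"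
  defines "s \<equiv> 1 / (1 + real (M div 2) * (p / ((1 - p) * (real n - 1))))"
  assumes l: "0 \<le> l" "l \<le> 1"
  shows "(\<Sum>r\<in>Pow {..<n}. measure (steps n p) {S. frog_trail n S (w, 0) = r} * l ^ card (r \<inter> U)) \<le> s + 2 * s * l + l\<^sup>2"
proof -
  interpret prob_space "steps n p" by (rule prob_space_iid_pmf)
  let ?P = "\<lambda>r. prob {S. frog_trail n S (w, 0) = r}"
  let ?m = "M div 2"
  have finU: "finite U" using U finite_subset by blast
  \<comment> \<open>\<open>U1\<close> and \<open>U2\<close> are disjoint of size
    \<open>M div 2\<close>, so each is avoided with probability exactly \<open>s\<close>.\<close>
  obtain U1 where U1: "U1 \<subseteq> U" "card U1 = ?m"
    using U(2) by (metis obtain_subset_with_card_n div_le_dividend order_trans)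
  have "?m \<le> card (U - U1)" using U1 U(2) finU by (subst card_Diff_subset) (auto intro: finite_subset)
  then obtain U2 where U2: "U2 \<subseteq> U - U1" "card U2 = ?m"
    by (metis obtain_subset_with_card_n)
  have avoid: "prob {S. frog_trail n S (w, 0) \<inter> V = {}} = s" if "V \<subseteq> U" "card V = ?m" for V
    unfolding s_def using that w U by (subst prob_frog_trail_avoids[OF n p]) auto
  have ev: "{S. Q (frog_trail n S (w, 0))} \<in> events" for Q
  proof -
    have "{S. Q (frog_trail n S (w, 0))} = (\<Union>r\<in>{r \<in> Pow {..<n}. Q r}. {S. frog_trail n S (w, 0) = r})"
      using frog_trail_subset[of "(w, 0)" n] w by auto
    also have "\<dots> \<in> events"
      using w by (intro sets.finite_UN frog_trail_eq_sets) auto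
    finally show ?thesis .
  qed
  \<comment> \<open>If \<open>r\<close> misses \<open>U1\<close>, the power is at most
    \<open>1\<close>; if it meets \<open>U1\<close> only, at most \<open>l\<close>; if it meets both
    sets, it has two elements in \<open>U\<close> and the power is at most
    \<open>l\<^sup>2\<close>.\<close>
  have *: "l ^ card (r \<inter> U) \<le> of_bool (r \<inter> U1 = {}) + l * of_bool (r \<inter> U1 = {}) + l * of_bool (r \<inter> U2 = {}) + l\<^sup>2" for r
  proof -
    have f1: "finite (r \<inter> U)" using finU by simp
    consider "r \<inter> U1 = {}" | "r \<inter> U1 \<noteq> {}" "r \<inter> U2 = {}" | "r \<inter> U1 \<noteq> {}" "r \<inter> U2 \<noteq> {}" by blast
    then show ?thesis
    proof cases
      case 1
      then show ?thesis using l by (simp add: power_le_one add_increasing2)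
    next
      case 2
      then have "card (r \<inter> U) \<ge> 1"
        using U1 f1 by (metis card_gt_0_iff Int_mono inf.orderE inf_bot_right less_eq_Suc_le One_nat_def order_refl subset_empty)
      then have "l ^ card (r \<inter> U) \<le> l ^ 1" using l by (intro power_decreasing) auto
      with 2 show ?thesis using l by (simp add: add_increasing2)
    next
      case 3
      then obtain a b where "a \<in> r \<inter> U1" "b \<in> r \<inter> U2" by blast
      then have "{a, b} \<subseteq> r \<inter> U" "a \<noteq> b" using U1 U2 by auto
      then have "2 \<le> card (r \<inter> U)" using card_mono[OF f1, of "{a, b}"] by simp
      then have "l ^ card (r \<inter> U) \<le> l\<^sup>2" using l by (intro power_decreasing) auto
      then show ?thesis using l by (simp add: add_increasing)
    qed
  qed
  have "(\<Sum>r\<in>Pow {..<n}. ?P r * l ^ card (r \<inter> U)) \<le>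
    (\<Sum>r\<in>Pow {..<n}. ?P r * (of_bool (r \<inter> U1 = {}) + l * of_bool (r \<inter> U1 = {}) + l * of_bool (r \<inter> U2 = {}) + l\<^sup>2))"
    by (intro sum_mono mult_left_mono * ) simp
  also have "\<dots> = (\<Sum>r\<in>Pow {..<n}. ?P r * of_bool (r \<inter> U1 = {})) +
     l * (\<Sum>r\<in>Pow {..<n}. ?P r * of_bool (r \<inter> U1 = {})) +
     l * (\<Sum>r\<in>Pow {..<n}. ?P r * of_bool (r \<inter> U2 = {})) + l\<^sup>2 * (\<Sum>r\<in>Pow {..<n}. ?P r * of_bool True)"
    unfolding distrib_left sum.distrib sum_distrib_left by (simp add: mult_ac)
  also have "\<dots> = s + l * s + l * s + l\<^sup>2"
  proof -
    have "prob {S. frog_trail n S (w, 0) \<inter> U1 = {}} = s" "prob {S. frog_trail n S (w, 0) \<inter> U2 = {}} = s"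
      using U1 U2 by (auto intro!: avoid)
    then show ?thesis
      using sum_prob_frog_trail[of "(w, 0)" n p "\<lambda>r. r \<inter> U1 = {}"] sum_prob_frog_trail[of "(w, 0)" n p "\<lambda>r. r \<inter> U2 = {}"]
        sum_prob_frog_trail[of "(w, 0)" n p "\<lambda>r. True"] prob_space w(1) by simp
  qed
  finally show ?thesis by (simp add: algebra_simps)
qed

text \<open>The exploration starts at \<open>X = {0}\<close> with weight \<open>l = 2 * s\<close>.
  The supermartingale condition becomes \<open>s + 8 * s * s \<le> 2 * s\<close>, which
  \<open>s \<le> 1 / 8\<close> ensures. A measurable superset \<open>E\<close> avoids proving
  measurability of the event itself.\<close>

lemma quenched_not_mostly_covered:
  fixes M :: nat
  assumes n: "n \<ge> 2" and p: "0 \<le> p" "p < 1" and G: "G \<subseteq> {..<n}" "0 \<in> G"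
    and GI: "\<And>v. v \<in> G \<Longrightarrow> (v, 0) \<in> particles n H"
  defines "s \<equiv> 1 / (1 + real (M div 2) * (p / ((1 - p) * (real n - 1))))"
  assumes s: "s \<le> 1 / 8"
  shows "\<exists>E \<in> sets (steps n p). measure (steps n p) E \<le> 2 * s \<and>
     {S. M \<le> card {v\<in>G. \<not> frog_visited n H S v}} \<subseteq> E"
proof (intro bexI conjI)
  let ?E = "{S. confined n M G {0} (frog_trail n S)}"
  have "s > 0" unfolding s_def using n p
    by (intro divide_pos_pos add_pos_nonneg mult_nonneg_nonneg divide_nonneg_nonneg) auto
  show "measure (steps n p) ?E \<le> 2 * s"
  proof -
    have "measure (steps n p) ?E \<le> (2 * s) ^ card {0::nat}"
    proof (rule prob_confined_le)
      fix w U assume wU: "w < n" "U \<subseteq> {..<n}" "w \<notin> U" "M \<le> card U"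
      have "(\<Sum>r\<in>Pow {..<n}. measure (steps n p) {S. frog_trail n S (w, 0) = r} * (2 * s) ^ card (r \<inter> U))
        \<le> s + 2 * s * (2 * s) + (2 * s)\<^sup>2"
        unfolding s_def using wU \<open>s > 0\<close> s
        by (intro frog_trail_generating_function_le n p) (auto simp: s_def)
      also have "\<dots> = s + 8 * s * s" by (simp add: power2_eq_square)
      also have "\<dots> \<le> 2 * s" using \<open>s > 0\<close> s by simp
      finally show "(\<Sum>r\<in>Pow {..<n}. measure (steps n p) {S. frog_trail n S (w, 0) = r} * (2 * s) ^ card (r \<inter> U)) \<le> 2 * s" .
    qed (use \<open>s > 0\<close> G in auto)
    then show ?thesis by simp
  qed
  show "?E \<in> sets (steps n p)"
    using G finite_subset by (intro confined_sets) blast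
  show "{S. M \<le> card {v\<in>G. \<not> frog_visited n H S v}} \<subseteq> ?E"
  proof
    fix S assume S: "S \<in> {S. M \<le> card {v\<in>G. \<not> frog_visited n H S v}}"
    \<comment> \<open>The closed set witnessing \<open>confined\<close> consists of the visited
      vertices of \<open>G\<close>: their particles are activated and lead only to visited
      vertices.\<close>
    have "G - {v\<in>G. frog_visited n H S v} = {v\<in>G. \<not> frog_visited n H S v}" by auto
    then show "S \<in> ?E"
      using S G GI by (auto simp: confined_def intro!: bexI[of _ "{v\<in>G. frog_visited n H S v}"]
        intro: frog_visited.root frog_trail_visited)
  qed
qed

section \<open>Union bound over the unvisited set\<close>

text \<open>\<open>f\<close> counts at most \<open>K\<close> particles per vertex. Unless the
  exploration fails, fewer than \<open>M\<close> vertices of \<open>G\<close> are unvisited, and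
  they hold at most \<open>K * M\<close> counted particles. Hence at least \<open>B\<close>
  activated particles avoid the unvisited set, and a union bound over its possible values
  applies.\<close>

lemma quenched_covered:
  fixes M :: nat
  assumes n: "n \<ge> 2" and p: "0 \<le> p" "p < 1"
    and f: "\<And>v. v < n \<Longrightarrow> enat (f v) \<le> H v" "\<And>v. v < n \<Longrightarrow> f v \<le> K"
    and sum_f: "real K * M + B \<le> (\<Sum>v<n. f v)" and B: "B \<ge> 0"
  defines "c \<equiv> p / ((1 - p) * (real n - 1))"
  assumes s: "1 / (1 + real (M div 2) * c) \<le> 1 / 8"
  shows "\<exists>E \<in> sets (steps n p). {S. frog_V n H S \<noteq> n} \<subseteq> E \<and> measure (steps n p) E \<le>
    2 / (1 + real (M div 2) * c) + (\<Sum>m\<in>{1..n}. real (n choose m) * exp (- B * ln (1 + m * c)))"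
proof -
  interpret prob_space "steps n p" by (rule prob_space_iid_pmf)
  have c: "c \<ge> 0" using n p by (auto simp: c_def)
  \<comment> \<open>The root belongs to \<open>G\<close> even if \<open>f 0 = 0\<close>, because of
    its additional particle.\<close>
  define G where "G = {v. v < n \<and> (v = 0 \<or> f v > 0)}"
  have GI: "(v, 0) \<in> particles n H" if "v \<in> G" for v
  proof -
    have "enat 0 < enat (f v)" if "f v > 0" using that by (simp add: zero_enat_def)
    then show ?thesis using that f(1)[of v] order_less_le_trans
      by (auto simp: G_def particles_def zero_enat_def[symmetric] add_pos_nonneg)
  qed
  have "\<exists>E \<in> events. prob E \<le> 2 * (1 / (1 + real (M div 2) * (p / ((1 - p) * (real n - 1))))) \<and>
     {S. M \<le> card {v\<in>G. \<not> frog_visited n H S v}} \<subseteq> E"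
    by (rule quenched_not_mostly_covered[OF n p _ _ GI])
      (use n s in \<open>auto simp: G_def c_def\<close>)
  then obtain E1 where E1: "E1 \<in> events" "prob E1 \<le> 2 / (1 + real (M div 2) * c)"
     "{S. M \<le> card {v\<in>G. \<not> frog_visited n H S v}} \<subseteq> E1"
    by (auto simp: c_def)
  \<comment> \<open>\<open>I U\<close> lists the counted particles starting outside
    \<open>U\<close>; \<open>W\<close> collects the nonempty candidates for the unvisited set that
    leave at least \<open>B\<close> of them.\<close>
  define I where "I U = Sigma ({..<n} - U) (\<lambda>v. {..<f v})" for U
  define E2 where "E2 U = {S. \<forall>i\<in>I U. frog_trail n S i \<inter> U = {}}" for U
  define W where "W = {U \<in> Pow {..<n} - {{}}. B \<le> card (I U)}"
  have finI: "finite (I U)" for U by (auto simp: I_def)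
  have E2_sets: "E2 U \<in> events" if "U \<in> W" for U
  proof -
    have "finite U" using that finite_subset by (auto simp: W_def)
    then have "Measurable.pred (steps n p) (\<lambda>S. \<forall>i\<in>I U. \<forall>u\<in>U. u \<notin> frog_trail n S i)"
      using finI by (intro pred_intros_finite pred_intros_logic) auto
    moreover have "E2 U = {S. \<forall>i\<in>I U. \<forall>u\<in>U. u \<notin> frog_trail n S i}"
      by (auto simp: E2_def)
    ultimately show ?thesis by (simp add: pred_def)
  qed
  have PE2: "prob (E2 U) \<le> exp (- B * ln (1 + card U * c))" if "U \<in> W" for U
  proof -
    have pos: "1 + card U * c \<ge> 1" using c by simp
    have "prob (E2 U) = (\<Prod>i\<in>I U. 1 / (1 + card U * c))"
      unfolding E2_def c_def using that finI by (intro prob_frog_trails_avoid n p) (auto simp: I_def W_def)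
    also have "\<dots> = exp (- card (I U) * ln (1 + card U * c))"
      using pos by (simp add: exp_minus exp_of_nat_mult power_one_over inverse_eq_divide)
    also have "\<dots> \<le> exp (- B * ln (1 + card U * c))"
      using that pos by (auto simp: W_def intro: mult_right_mono)
    finally show ?thesis .
  qed
  have sub: "{S. frog_V n H S \<noteq> n} \<subseteq> E1 \<union> (\<Union>U\<in>W. E2 U)"
  proof
    fix S assume S: "S \<in> {S. frog_V n H S \<noteq> n}"
    define U where "U = {v. v < n \<and> \<not> frog_visited n H S v}"
    show "S \<in> E1 \<union> (\<Union>U\<in>W. E2 U)"
    proof (cases "M \<le> card {v\<in>G. \<not> frog_visited n H S v}")
      case True
      then show ?thesis using E1(3) by blast
    next
      case False
      \<comment> \<open>Unvisited vertices outside \<open>G\<close> satisfy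
        \<open>f v = 0\<close>.\<close>
      have "(\<Sum>v\<in>U. f v) = (\<Sum>v\<in>{v\<in>G. \<not> frog_visited n H S v}. f v)"
        by (intro sum.mono_neutral_right) (auto simp: U_def G_def)
      also have "\<dots> \<le> (\<Sum>v\<in>{v\<in>G. \<not> frog_visited n H S v}. K)"
        using f(2) by (intro sum_mono) (auto simp: G_def)
      also have "\<dots> = card {v\<in>G. \<not> frog_visited n H S v} * K" by simp
      also have "\<dots> \<le> M * K" using False by (intro mult_right_mono) auto
      finally have "(\<Sum>v\<in>U. f v) \<le> M * K" .
      then have 1: "real (\<Sum>v\<in>U. f v) \<le> M * K" by (simp only: of_nat_le_iff flip: of_nat_mult)
      have "(\<Sum>v<n. f v) = (\<Sum>v\<in>{..<n} - U. f v) + (\<Sum>v\<in>U. f v)"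
        by (rule sum.subset_diff) (auto simp: U_def)
      also have "(\<Sum>v\<in>{..<n} - U. f v) = card (I U)"
        by (simp add: I_def)
      finally have "(\<Sum>v<n. f v) = card (I U) + (\<Sum>v\<in>U. f v)" .
      from arg_cong[OF this, of real] have "B \<le> card (I U)"
        using 1 sum_f by (simp add: mult.commute)
      moreover have "U \<noteq> {}" using S by (auto simp: U_def frog_V_eq_iff)
      ultimately have "U \<in> W" by (auto simp: W_def U_def)
      moreover have "S \<in> E2 U"
        unfolding E2_def
      proof (intro CollectI ballI)
        fix i assume i: "i \<in> I U"
        obtain v j where vj: "i = (v, j)" by (cases i)
        have v: "v < n" "frog_visited n H S v" "j < f v" using i by (auto simp: I_def vj U_def)
        have "enat j < H v" using f(1)[OF v(1)] v(3) order_less_le_trans[of "enat j" "enat (f v)"] by simp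
        then have "(v, j) \<in> particles n H" using v
          by (auto simp: particles_def intro: order_less_le_trans)
        then show "frog_trail n S i \<inter> U = {}"
          using frog_trail_visited[OF v(2), of j] by (auto simp: vj U_def)
      qed
      ultimately show ?thesis by blast
    qed
  qed
  have finW: "finite W" by (auto simp: W_def)
  have "prob (\<Union>U\<in>W. E2 U) \<le> (\<Sum>U\<in>W. prob (E2 U))"
    using finW E2_sets by (intro finite_measure_subadditive_finite) auto
  also have "\<dots> \<le> (\<Sum>U\<in>W. exp (- B * ln (1 + card U * c)))"
    by (intro sum_mono PE2)
  also have "\<dots> \<le> (\<Sum>U\<in>Pow {..<n} - {{}}. exp (- B * ln (1 + card U * c)))"
    by (intro sum_mono2) (auto simp: W_def)
  \<comment> \<open>The subtracted \<open>1\<close> is the term of the empty set, later the term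
    \<open>m = 0\<close>.\<close>
  also have "\<dots> = (\<Sum>U\<in>Pow {..<n}. exp (- B * ln (1 + card U * c))) - 1"
    by (subst sum_diff1) auto
  also have "\<dots> = (\<Sum>m\<le>n. real (n choose m) * exp (- B * ln (1 + m * c))) - 1"
    using sum_Pow_by_card[of "{..<n}" "\<lambda>m. exp (- B * ln (1 + m * c))"] by simp
  also have "\<dots> = (\<Sum>m\<in>{1..n}. real (n choose m) * exp (- B * ln (1 + m * c)))"
    by (simp add: atMost_atLeast0 sum.atLeast_Suc_atMost)
  finally have "prob (\<Union>U\<in>W. E2 U) \<le> (\<Sum>m\<in>{1..n}. real (n choose m) * exp (- B * ln (1 + m * c)))" .
  moreover have UNev: "(\<Union>U\<in>W. E2 U) \<in> events" using finW E2_sets by auto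
  moreover have "prob (E1 \<union> (\<Union>U\<in>W. E2 U)) \<le> prob E1 + prob (\<Union>U\<in>W. E2 U)"
    using E1 UNev by (intro measure_Un_le)
  ultimately show ?thesis
    using E1 sub by (intro bexI[of _ "E1 \<union> (\<Union>U\<in>W. E2 U)"]) auto
qed

subsection \<open>Averaging over the initial configuration\<close>

text \<open>Fubini with a bad set: the quenched bound \<open>\<delta>\<close> is used outside
  \<open>B\<close>, the trivial bound \<open>1\<close> inside.\<close>

lemma prob_pair_le:
  assumes "prob_space M" "prob_space N" and E: "E \<in> sets (M \<Otimes>\<^sub>M N)" and B: "B \<in> sets M"
    and le: "\<And>x. x \<in> space M - B \<Longrightarrow> measure N (Pair x -` E) \<le> \<delta>" and \<delta>: "0 \<le> \<delta>"
  shows "measure (M \<Otimes>\<^sub>M N) E \<le> measure M B + \<delta>"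
proof -
  interpret M: prob_space M by fact
  interpret N: prob_space N by fact
  interpret P: pair_prob_space M N ..
  have "emeasure (M \<Otimes>\<^sub>M N) E = (\<integral>\<^sup>+x. emeasure N (Pair x -` E) \<partial>M)"
    by (rule N.emeasure_pair_measure_alt[OF E])
  also have "\<dots> \<le> (\<integral>\<^sup>+x. indicator B x + ennreal \<delta> \<partial>M)"
  proof (rule nn_integral_mono)
    fix x assume x: "x \<in> space M"
    show "emeasure N (Pair x -` E) \<le> indicator B x + ennreal \<delta>"
    proof (cases "x \<in> B")
      case True
      then show ?thesis using N.measure_le_1[of "Pair x -` E"] by (simp add: add_increasing2)
    next
      case False
      then show ?thesis using le[of x] x by (simp add: N.emeasure_eq_measure ennreal_leI)
    qed
  qed
  also have "\<dots> = emeasure M B + ennreal \<delta>"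
    using B by (subst nn_integral_add) (auto simp: M.emeasure_space_1)
  finally show ?thesis
    using \<delta> by (simp add: P.emeasure_eq_measure M.emeasure_eq_measure flip: ennreal_plus)
qed

lemma expectation_coordinate:
  fixes g :: "'v \<Rightarrow> real"
  shows "integral\<^sup>L (iid_pmf q) (\<lambda>\<omega>. g (\<omega> i)) = measure_pmf.expectation q g"
proof -
  have "measure_pmf.expectation q g = integral\<^sup>L (distr (iid_pmf q) (measure_pmf q) (\<lambda>\<omega>. \<omega> i)) g"
    by (subst distr_PiM_component) (auto simp: prob_space_measure_pmf)
  also have "\<dots> = integral\<^sup>L (iid_pmf q) (\<lambda>\<omega>. g (\<omega> i))"
    by (rule integral_distr) auto
  finally show ?thesis ..
qed

lemma nn_integral_coordinate:
  "(\<integral>\<^sup>+\<omega>. g (\<omega> i) \<partial>iid_pmf q) = (\<integral>\<^sup>+x. g x \<partial>measure_pmf q)"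
proof -
  have "(\<integral>\<^sup>+x. g x \<partial>measure_pmf q) = integral\<^sup>N (distr (iid_pmf q) (measure_pmf q) (\<lambda>\<omega>. \<omega> i)) g"
    by (subst distr_PiM_component) (auto simp: prob_space_measure_pmf)
  also have "\<dots> = (\<integral>\<^sup>+\<omega>. g (\<omega> i) \<partial>iid_pmf q)"
    by (rule nn_integral_distr) auto
  finally show ?thesis ..
qed

lemma iid_pmf_Hoeffding:
  fixes g :: "'v \<Rightarrow> real" and q :: "'v pmf" and n :: nat and m K \<epsilon> :: real
  assumes g: "\<And>x. 0 \<le> g x" "\<And>x. g x \<le> K" and K: "K > 0" and n: "n > 0" and \<epsilon>: "\<epsilon> \<ge> 0"
  defines "m \<equiv> measure_pmf.expectation q g"
  shows "measure (iid_pmf q) {\<omega>. (\<Sum>v<n. g (\<omega> v)) \<ge> n * (m + \<epsilon>)} \<le> exp (- 2 * \<epsilon>\<^sup>2 / K\<^sup>2 * n)"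
    and "measure (iid_pmf q) {\<omega>. (\<Sum>v<n. g (\<omega> v)) \<le> n * (m - \<epsilon>)} \<le> exp (- 2 * \<epsilon>\<^sup>2 / K\<^sup>2 * n)"
proof -
  interpret prob_space "iid_pmf q :: (nat \<Rightarrow> 'v) measure" by (rule prob_space_iid_pmf)
  have "indep_vars (\<lambda>_. borel) (\<lambda>v \<omega>. g (\<omega> v)) {..<n}"
    by (rule indep_vars_compose2[OF indep_vars_subset[OF iid_pmf_indep_coordinates]]) auto
  then interpret Hoeffding_ineq "iid_pmf q :: (nat \<Rightarrow> 'v) measure" "{..<n}" "\<lambda>v \<omega>. g (\<omega> v)"
    "\<lambda>_. 0" "\<lambda>_. K" "\<Sum>v<n. expectation (\<lambda>\<omega>. g (\<omega> v))"
    using g by unfold_locales auto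
  have \<mu>: "(\<Sum>v<n. expectation (\<lambda>\<omega>. g (\<omega> v))) = n * m"
    by (simp add: expectation_coordinate m_def)
  have *: "(\<Sum>i<n. (K - 0)\<^sup>2) = n * K\<^sup>2" by simp
  have e: "- 2 * (n * \<epsilon>)\<^sup>2 / (n * K\<^sup>2) = - 2 * \<epsilon>\<^sup>2 / K\<^sup>2 * n"
    using n by (simp add: power2_eq_square field_simps)
  have pos: "0 < (\<Sum>i<n. (K - 0)\<^sup>2)" "0 \<le> n * \<epsilon>" using n K \<epsilon> by auto
  show "measure (iid_pmf q) {\<omega>. (\<Sum>v<n. g (\<omega> v)) \<ge> n * (m + \<epsilon>)} \<le> exp (- 2 * \<epsilon>\<^sup>2 / K\<^sup>2 * n)"
    using Hoeffding_ineq_ge[OF pos(2,1)] unfolding \<mu> * e by (simp add: distrib_left)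
  show "measure (iid_pmf q) {\<omega>. (\<Sum>v<n. g (\<omega> v)) \<le> n * (m - \<epsilon>)} \<le> exp (- 2 * \<epsilon>\<^sup>2 / K\<^sup>2 * n)"
    using Hoeffding_ineq_le[OF pos(2,1)] unfolding \<mu> * e by (simp add: right_diff_distrib)
qed

section \<open>Truncated particle numbers and the weak law of large numbers\<close>

definition trunc :: "nat \<Rightarrow> enat \<Rightarrow> nat" where
  "trunc K x = the_enat (min x (enat K))"

lemma enat_trunc: "enat (trunc K x) = min x (enat K)"
  by (cases x) (auto simp: trunc_def min_def)

lemma trunc_le: "trunc K x \<le> K" "enat (trunc K x) \<le> x"
  using enat_trunc[of K x] by (metis enat_ord_simps(1) min.cobounded2, metis min.cobounded1)

lemma nn_integral_trunc:
  "(\<integral>\<^sup>+x. of_nat (trunc K x) \<partial>measure_pmf eta) = ennreal (measure_pmf.expectation eta (\<lambda>x. real (trunc K x)))"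
proof -
  have "integrable (measure_pmf eta) (\<lambda>x. real (trunc K x))"
    by (rule measure_pmf.integrable_const_bound[where B = "real K"]) (auto simp: trunc_le)
  from nn_integral_eq_integral[OF this] show ?thesis by (simp add: ennreal_of_nat_eq_real_of_nat)
qed

text \<open>Monotone convergence in \<open>K\<close>. It yields a truncation with mean above any
  given value below the expectation, also when the latter is infinite.\<close>

lemma frog_expect_SUP_trunc:
  "frog_expect eta = (SUP K. ennreal (measure_pmf.expectation eta (\<lambda>x. real (trunc K x))))"
    and incseq_expectation_trunc: "incseq (\<lambda>K. ennreal (measure_pmf.expectation eta (\<lambda>x. real (trunc K x))))"
proof -
  have inc: "incseq (\<lambda>K x. of_nat (trunc K x) :: ennreal)"
  proof (intro incseq_SucI le_funI)
    fix K x
    have "enat (trunc K x) \<le> enat (trunc (Suc K) x)"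
      unfolding enat_trunc by (intro min.mono) auto
    then show "(of_nat (trunc K x) :: ennreal) \<le> of_nat (trunc (Suc K) x)" by simp
  qed
  have sup: "(SUP K. of_nat (trunc K x)) = ennreal_of_enat x" for x
  proof (cases x)
    case (enat k)
    show ?thesis
    proof (rule antisym)
      show "(SUP K. of_nat (trunc K x)) \<le> ennreal_of_enat x"
        using enat trunc_le(2)[of _ x] by (intro SUP_least) (simp add: ennreal_of_enat_enat)
      have "of_nat (trunc k x) \<le> (SUP K. of_nat (trunc K x) :: ennreal)" by (rule SUP_upper) simp
      moreover have "trunc k x = k" using enat by (simp add: trunc_def)
      ultimately show "ennreal_of_enat x \<le> (SUP K. of_nat (trunc K x))"
        using enat by (simp add: ennreal_of_enat_enat)
    qed
  next
    case infinity
    then have "trunc K x = K" for K by (simp add: trunc_def)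
    then show ?thesis using infinity by (simp add: ennreal_SUP_of_nat_eq_top)
  qed
  have "frog_expect eta = (\<integral>\<^sup>+x. (SUP K. of_nat (trunc K x)) \<partial>measure_pmf eta)"
    unfolding frog_expect_def sup ..
  also have "\<dots> = (SUP K. \<integral>\<^sup>+x. of_nat (trunc K x) \<partial>measure_pmf eta)"
    by (rule nn_integral_monotone_convergence_SUP[OF inc]) simp
  finally show "frog_expect eta = (SUP K. ennreal (measure_pmf.expectation eta (\<lambda>x. real (trunc K x))))"
    unfolding nn_integral_trunc .
  show "incseq (\<lambda>K. ennreal (measure_pmf.expectation eta (\<lambda>x. real (trunc K x))))"
    unfolding nn_integral_trunc[symmetric] using inc
    by (auto simp: incseq_def le_fun_def intro!: nn_integral_mono)
qed

lemma exp_neg_mult_tendsto_0: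
  fixes k :: real
  assumes "k > 0"
  shows "(\<lambda>n. exp (- k * real n)) \<longlonglongrightarrow> 0"
  using assms by real_asymp

text \<open>Only a finite mean is assumed. The part truncated at \<open>K\<close> is controlled by
  Hoeffding's inequality, the excess by Markov's, its mean \<open>\<mu> - m K\<close> being small
  for large \<open>K\<close>.\<close>

lemma weak_law_upper:
  assumes \<mu>: "frog_expect eta < ennreal \<beta>"
  shows "(\<lambda>n. measure (iid_pmf eta) {H. (\<Sum>v<n. ennreal_of_enat (H v)) > ennreal (real n * \<beta>)}) \<longlonglongrightarrow> 0"
proof -
  interpret prob_space "iid_pmf eta :: (nat \<Rightarrow> enat) measure" by (rule prob_space_iid_pmf)
  define m where "m K = measure_pmf.expectation eta (\<lambda>x. real (trunc K x))" for K
  obtain \<mu> where \<mu>: "frog_expect eta = ennreal \<mu>" "0 \<le> \<mu>"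
    using assms by (cases "frog_expect eta") auto
  then have "\<mu> < \<beta>" using assms by (simp add: ennreal_less_iff)
  have m0: "0 \<le> m K" for K by (simp add: m_def)
  have "(\<lambda>K. ennreal (m K)) \<longlonglongrightarrow> ennreal \<mu>"
    using LIMSEQ_SUP[OF incseq_expectation_trunc[of eta]] frog_expect_SUP_trunc[of eta] \<mu>
    by (simp add: m_def)
  then have mlim: "m \<longlonglongrightarrow> \<mu>"
    using m0 \<mu> by (subst (asm) tendsto_ennreal_iff) auto
  \<comment> \<open>Half the gap between \<open>\<mu>\<close> and \<open>\<beta>\<close>: one
    \<open>\<epsilon>\<close> for the truncated part, one for the excess.\<close>
  define \<epsilon> where "\<epsilon> = (\<beta> - \<mu>) / 2"
  have \<epsilon>: "\<epsilon> > 0" "\<mu> + \<epsilon> + \<epsilon> = \<beta>" using \<open>\<mu> < \<beta>\<close> by (auto simp: \<epsilon>_def field_simps)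
  define e where "e K x = ennreal_of_enat (x - enat K)" for K and x :: enat
  have split: "ennreal_of_enat x = of_nat (trunc K x) + e K x" for K x
  proof (cases x)
    case (enat k)
    then show ?thesis by (auto simp: trunc_def e_def min_def ennreal_of_enat_enat simp flip: of_nat_add)
  qed (simp add: trunc_def e_def)
  have mle: "m K \<le> \<mu>" for K
  proof -
    have "ennreal (m K) \<le> ennreal \<mu>"
      unfolding \<mu>(1)[symmetric] frog_expect_SUP_trunc m_def by (rule SUP_upper) simp
    then show ?thesis using \<mu>(2) by simp
  qed
  have ex: "(\<integral>\<^sup>+x. e K x \<partial>measure_pmf eta) = ennreal (\<mu> - m K)" for K
  proof -
    have "ennreal \<mu> = ennreal (m K) + (\<integral>\<^sup>+x. e K x \<partial>measure_pmf eta)"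
      unfolding \<mu>(1)[symmetric] frog_expect_def split[of _ K] m_def nn_integral_trunc[symmetric]
      by (rule nn_integral_add) auto
    moreover have "ennreal \<mu> = ennreal (m K) + ennreal (\<mu> - m K)"
      using m0 mle by (simp flip: ennreal_plus)
    ultimately have "ennreal (m K) + (\<integral>\<^sup>+x. e K x \<partial>measure_pmf eta) = ennreal (m K) + ennreal (\<mu> - m K)"
      by (rule trans[OF sym])
    then show ?thesis unfolding ennreal_add_left_cancel by simp
  qed
  have bound: "prob {H. (\<Sum>v<n. ennreal_of_enat (H v)) > ennreal (real n * \<beta>)} \<le>
      exp (- 2 * \<epsilon>\<^sup>2 / (real K)\<^sup>2 * n) + (\<mu> - m K) / \<epsilon>" if K: "K > 0" and n: "n > 0" for K n
  proof -
    let ?A = "{H. (\<Sum>v<n. real (trunc K (H v))) \<ge> n * (m K + \<epsilon>)}"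
    let ?B = "{H. (\<Sum>v<n. e K (H v)) \<ge> ennreal (n * \<epsilon>)}"
    have A_ev: "?A \<in> events"
    proof -
      have "Measurable.pred (iid_pmf eta) (\<lambda>H. (\<Sum>v<n. real (trunc K (H v))) \<ge> n * (m K + \<epsilon>))"
        by measurable
      then show ?thesis by (simp add: pred_def)
    qed
    have B_ev: "?B \<in> events"
    proof -
      have "Measurable.pred (iid_pmf eta) (\<lambda>H. (\<Sum>v<n. e K (H v)) \<ge> ennreal (n * \<epsilon>))"
        by measurable
      then show ?thesis by (simp add: pred_def)
    qed
    have sub: "{H. (\<Sum>v<n. ennreal_of_enat (H v)) > ennreal (real n * \<beta>)} \<subseteq> ?A \<union> ?B"
    proof (rule subsetI, rule ccontr)
      fix H assume H: "H \<in> {H. (\<Sum>v<n. ennreal_of_enat (H v)) > ennreal (real n * \<beta>)}" "H \<notin> ?A \<union> ?B"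
      have "(\<Sum>v<n. ennreal_of_enat (H v)) = (\<Sum>v<n. of_nat (trunc K (H v))) + (\<Sum>v<n. e K (H v))"
        unfolding split[of _ K] by (rule sum.distrib)
      also have "(\<Sum>v<n. of_nat (trunc K (H v))) = ennreal (\<Sum>v<n. real (trunc K (H v)))"
        by (subst sum_ennreal[symmetric]) (auto simp: ennreal_of_nat_eq_real_of_nat)
      also have "\<dots> + (\<Sum>v<n. e K (H v)) \<le> ennreal (n * (\<mu> + \<epsilon>)) + ennreal (n * \<epsilon>)"
      proof (intro add_mono ennreal_leI)
        have "n * (m K + \<epsilon>) \<le> n * (\<mu> + \<epsilon>)" using mle[of K] by (simp add: mult_left_mono)
        then show "(\<Sum>v<n. real (trunc K (H v))) \<le> n * (\<mu> + \<epsilon>)" using H(2) by simp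
      qed (use H(2) in auto)
      also have "\<dots> = ennreal (n * \<beta>)"
        using \<mu>(2) \<epsilon>(1) by (simp add: \<epsilon>(2)[symmetric] distrib_left flip: ennreal_plus)
      finally show False using H(1) by simp
    qed
    have "emeasure (iid_pmf eta) {H \<in> space (iid_pmf eta). 1 \<le> ennreal (1 / (n * \<epsilon>)) * (\<Sum>v<n. e K (H v))}
      \<le> ennreal (1 / (n * \<epsilon>)) * (\<integral>\<^sup>+H. (\<Sum>v<n. e K (H v)) * indicator (space (iid_pmf eta)) H \<partial>iid_pmf eta)"
      by (intro nn_integral_Markov_inequality sets.top) measurable
    also have "(\<integral>\<^sup>+H. (\<Sum>v<n. e K (H v)) * indicator (space (iid_pmf eta)) H \<partial>iid_pmf eta) =
       (\<Sum>v<n. \<integral>\<^sup>+H. e K (H v) \<partial>iid_pmf eta)"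
      by (subst nn_integral_sum[symmetric]) auto
    also have "\<dots> = ennreal (n * (\<mu> - m K))"
      using mle[of K] by (simp add: nn_integral_coordinate ex ennreal_of_nat_eq_real_of_nat ennreal_mult)
    also have "ennreal (1 / (n * \<epsilon>)) * \<dots> = ennreal ((\<mu> - m K) / \<epsilon>)"
      using n \<epsilon> mle[of K] by (simp flip: ennreal_mult)
    finally have "emeasure (iid_pmf eta) {H. 1 \<le> ennreal (1 / (n * \<epsilon>)) * (\<Sum>v<n. e K (H v))} \<le> ennreal ((\<mu> - m K) / \<epsilon>)"
      by simp
    moreover have "?B \<subseteq> {H. 1 \<le> ennreal (1 / (n * \<epsilon>)) * (\<Sum>v<n. e K (H v))}"
    proof
      fix H assume "H \<in> ?B"
      then have "ennreal (1 / (n * \<epsilon>)) * ennreal (n * \<epsilon>) \<le> ennreal (1 / (n * \<epsilon>)) * (\<Sum>v<n. e K (H v))"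
        by (intro mult_left_mono) auto
      moreover have "ennreal (1 / (n * \<epsilon>)) * ennreal (n * \<epsilon>) = 1"
        using n \<epsilon> by (simp flip: ennreal_mult)
      ultimately show "H \<in> {H. 1 \<le> ennreal (1 / (n * \<epsilon>)) * (\<Sum>v<n. e K (H v))}" by simp
    qed
    moreover have "{H. 1 \<le> ennreal (1 / (n * \<epsilon>)) * (\<Sum>v<n. e K (H v))} \<in> events"
    proof -
      have "Measurable.pred (iid_pmf eta) (\<lambda>H. 1 \<le> ennreal (1 / (n * \<epsilon>)) * (\<Sum>v<n. e K (H v)))"
        by measurable
      then show ?thesis by (simp add: pred_def)
    qed
    ultimately have "emeasure (iid_pmf eta) ?B \<le> ennreal ((\<mu> - m K) / \<epsilon>)"
      by (meson emeasure_mono order_trans)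
    then have PB: "prob ?B \<le> (\<mu> - m K) / \<epsilon>"
      using mle[of K] \<epsilon> by (simp add: emeasure_eq_measure)
    have "prob {H. (\<Sum>v<n. ennreal_of_enat (H v)) > ennreal (real n * \<beta>)} \<le> prob (?A \<union> ?B)"
      using sub A_ev B_ev by (intro finite_measure_mono) auto
    also have "\<dots> \<le> prob ?A + prob ?B" using A_ev B_ev by (rule measure_Un_le)
    also have "prob ?A \<le> exp (- 2 * \<epsilon>\<^sup>2 / (real K)\<^sup>2 * n)"
      unfolding m_def using K n \<epsilon> by (intro iid_pmf_Hoeffding) (auto simp: trunc_le)
    finally show ?thesis using PB by simp
  qed
  show ?thesis
  proof (rule LIMSEQ_I)
    fix r :: real assume r: "r > 0"
    \<comment> \<open>First \<open>K\<close> is fixed so that the Markov term is small, then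
      \<open>n\<close> is taken large in the Hoeffding term.\<close>
    have "(\<lambda>K. (\<mu> - m K) / \<epsilon>) \<longlonglongrightarrow> (\<mu> - \<mu>) / \<epsilon>"
      using \<epsilon>(1) by (intro tendsto_intros mlim) auto
    then have "\<forall>\<^sub>F K in sequentially. (\<mu> - m K) / \<epsilon> < r / 2"
      by (rule order_tendstoD(2)) (use r in simp)
    then have "\<forall>\<^sub>F K in sequentially. (\<mu> - m K) / \<epsilon> < r / 2 \<and> K > 0"
      by (intro eventually_conj eventually_gt_at_top)
    then obtain K where K: "(\<mu> - m K) / \<epsilon> < r / 2" "K > 0"
      by (metis (no_types, lifting) eventually_sequentially order_refl)
    have "(\<lambda>n. exp (- (2 * \<epsilon>\<^sup>2 / (real K)\<^sup>2) * real n)) \<longlonglongrightarrow> 0"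
      using K(2) \<epsilon>(1) by (intro exp_neg_mult_tendsto_0) simp
    then have "\<forall>\<^sub>F n in sequentially. exp (- (2 * \<epsilon>\<^sup>2 / (real K)\<^sup>2) * real n) < r / 2"
      by (rule order_tendstoD(2)) (use r in simp)
    then have "\<forall>\<^sub>F n in sequentially. exp (- (2 * \<epsilon>\<^sup>2 / (real K)\<^sup>2) * real n) < r / 2 \<and> n > 0"
      by (intro eventually_conj eventually_gt_at_top)
    then obtain n0 where n0: "\<And>n. n \<ge> n0 \<Longrightarrow> exp (- (2 * \<epsilon>\<^sup>2 / (real K)\<^sup>2) * real n) < r / 2 \<and> n > 0"
      unfolding eventually_sequentially by blast
    show "\<exists>no. \<forall>n\<ge>no. norm (prob {H. (\<Sum>v<n. ennreal_of_enat (H v)) > ennreal (real n * \<beta>)} - 0) < r"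
    proof (intro exI[of _ n0] allI impI)
      fix n assume "n \<ge> n0"
      then show "norm (prob {H. (\<Sum>v<n. ennreal_of_enat (H v)) > ennreal (real n * \<beta>)} - 0) < r"
      proof -
        have "prob {H. (\<Sum>v<n. ennreal_of_enat (H v)) > ennreal (real n * \<beta>)}
          \<le> exp (- (2 * \<epsilon>\<^sup>2 / (real K)\<^sup>2) * real n) + (\<mu> - m K) / \<epsilon>"
          using bound[OF K(2), of n] n0[OF \<open>n \<ge> n0\<close>] by simp
        also have "\<dots> < r" using n0[OF \<open>n \<ge> n0\<close>] K(1) by linarith
        finally show ?thesis by simp
      qed
    qed
  qed
qed

subsection \<open>Asymptotics of the union bound\<close>

text \<open>Keep one term of the expansion of \<open>(z + 1) ^ n\<close> and use
  \<open>z + 1 \<le> exp z\<close>. For \<open>m\<close> of smaller order than \<open>n\<close>, a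
  small \<open>z\<close> makes the exponent a small multiple of \<open>n\<close>.\<close>

lemma binomial_le_exp:
  assumes "0 < z" "m \<le> n"
  shows "real (n choose m) \<le> exp (z * n - m * ln z)"
proof -
  have "real (n choose m) * z ^ m \<le> (\<Sum>k\<le>n. real (n choose k) * z ^ k * 1 ^ (n - k))"
    using assms by (intro order_trans[OF _ member_le_sum[of m]]) auto
  also have "\<dots> = (z + 1) ^ n" by (rule binomial_ring[symmetric])
  also have "\<dots> \<le> exp z ^ n"
    using assms exp_ge_add_one_self[of z] by (intro power_mono) (auto simp: add.commute)
  also have "\<dots> = exp (z * n)" by (metis exp_of_nat2_mult)
  finally have "real (n choose m) \<le> exp (z * n) / z ^ m"
    using assms by (simp add: field_simps)
  also have "z ^ m = exp (m * ln z)" using assms by (simp add: exp_of_nat_mult)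
  finally show ?thesis by (simp add: exp_diff)
qed

lemma binomial_le_power: "real (n choose m) \<le> real n ^ m"
proof (cases "m \<le> n")
  case True
  then show ?thesis using binomial_le_pow[OF True] by (metis of_nat_le_iff of_nat_power)
qed (simp add: binomial_eq_0)

text \<open>The union bound over unvisited sets of size \<open>m\<close>, in three regimes of \<open>y = m c\<close>: for small \<open>y\<close>
  the bound \<open>n ^ m\<close> on the binomial coefficient suffices, since \<open>b > \<alpha>\<close>; for bounded \<open>y\<close> one has
  \<open>m = O(n / ln n)\<close>, so that the binomial coefficient is subexponential up to \<open>exp (z n)\<close>; for large
  \<open>y\<close> the bound \<open>2 ^ n\<close> suffices.\<close>

lemma binomial_sum_tendsto_0:
  fixes c :: "nat \<Rightarrow> real" and b \<alpha> :: real
  assumes \<alpha>: "0 < \<alpha>" "\<alpha> < b"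
    and c: "\<forall>\<^sub>F n in sequentially. ln (real n) / \<alpha> - 1 \<le> real n * c n"
  shows "(\<lambda>n. \<Sum>m\<in>{1..n}. real (n choose m) * exp (- (b * n) * ln (1 + m * c n))) \<longlonglongrightarrow> 0"
proof -
  have b: "b > 0" using \<alpha> by simp
  \<comment> \<open>Makes \<open>\<alpha> * (1 + y0)\<close> the midpoint of \<open>\<alpha>\<close>
    and \<open>b\<close>, so that \<open>k\<close> is positive.\<close>
  define y0 where "y0 = (b / \<alpha> - 1) / 2"
  have y0: "y0 > 0" using \<alpha> by (simp add: y0_def)
  define k where "k = b / (\<alpha> * (1 + y0)) - 1"
  have k: "k > 0"
  proof -
    have "\<alpha> * (1 + y0) = (\<alpha> + b) / 2" using \<alpha> by (simp add: y0_def field_simps)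
    also have "\<dots> < b" using \<alpha> by simp
    finally show ?thesis using \<alpha> y0 by (simp add: k_def)
  qed
  define k' where "k' = b / (1 + y0)"
  \<comment> \<open>Here \<open>b * ln y1 = ln 2 + 1\<close>, which beats \<open>2 ^ n\<close> with
    a factor \<open>exp (- n)\<close> to spare.\<close>
  define y1 where "y1 = exp ((ln 2 + 1) / b)"
  define w0 where "w0 = b * ln (1 + y0)"
  have w0: "w0 > 0" using b y0 by (simp add: w0_def)
  \<comment> \<open>In the middle regime the decay is \<open>exp (- w0 * n)\<close>. The terms
    \<open>z * n\<close> and \<open>- m * ln z\<close> each cost at most a quarter of the exponent,
    so half of it remains.\<close>
  define z where "z = min (w0 / 4) (1 / 2)"
  have z: "z > 0" "z \<le> w0 / 4" "z \<le> 1 / 2" using w0 by (auto simp: z_def)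
  then have lz: "ln z < 0" by simp
  define w where "w = min 1 (w0 / 2)"
  have w: "w > 0" using w0 by (simp add: w_def)
  define q where "q n = exp (- (k * ln (real n) - k'))" for n
  have ev: "\<forall>\<^sub>F n in sequentially. 1 \<le> real n" "\<forall>\<^sub>F n in sequentially. ln (real n) / \<alpha> - 1 > 0"
     "\<forall>\<^sub>F n in sequentially. y1 * (- ln z) / (ln (real n) / \<alpha> - 1) < w0 / 4"
     "\<forall>\<^sub>F n in sequentially. q n < 1 / 2"
  proof -
    show "\<forall>\<^sub>F n in sequentially. 1 \<le> real n" by real_asymp
    show "\<forall>\<^sub>F n in sequentially. ln (real n) / \<alpha> - 1 > 0" using \<alpha>(1) by real_asymp
    have "(\<lambda>n. y1 * (- ln z) / (ln (real n) / \<alpha> - 1)) \<longlonglongrightarrow> 0" using \<alpha>(1) by real_asymp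
    then show "\<forall>\<^sub>F n in sequentially. y1 * (- ln z) / (ln (real n) / \<alpha> - 1) < w0 / 4"
      by (rule order_tendstoD(2)) (use w0 in simp)
    have "q \<longlonglongrightarrow> 0" unfolding q_def using k by real_asymp
    then show "\<forall>\<^sub>F n in sequentially. q n < 1 / 2" by (rule order_tendstoD(2)) simp
  qed
  have summand: "real (n choose m) * exp (- (b * n) * ln (1 + m * c n)) \<le> q n ^ m + exp (- w * n)"
    if n: "1 \<le> real n" "ln (real n) / \<alpha> - 1 > 0" "ln (real n) / \<alpha> - 1 \<le> real n * c n"
      "y1 * (- ln z) / (ln (real n) / \<alpha> - 1) < w0 / 4" and m: "m \<in> {1..n}" for n m
  proof -
    define L where "L = ln (real n) / \<alpha> - 1"
    have L: "L > 0" "L \<le> n * c n" using n by (auto simp: L_def)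
    then have "c n > 0" using n(1) by (metis less_le_trans not_one_le_zero of_nat_0_le_iff zero_less_mult_pos order_le_less)
    define y where "y = m * c n"
    have y: "y > 0" using m \<open>c n > 0\<close> by (simp add: y_def)
    consider "y \<le> y0" | "y0 < y" "y \<le> y1" | "y1 < y" by linarith
    then show ?thesis
    proof cases
      case 1
      \<comment> \<open>The inequality \<open>y / (1 + y) \<le> ln (1 + y)\<close> linearises the
        logarithm, losing at most a factor \<open>1 + y0\<close>.\<close>
      have "y / (1 + y0) \<le> y / (1 + y)" using y 1 by (intro divide_left_mono) auto
      also have "y / (1 + y) \<le> ln (1 + y)"
      proof -
        have "ln (1 / (1 + y)) \<le> 1 / (1 + y) - 1" using y by (intro ln_le_minus_one) simp
        moreover have "1 / (1 + y) - 1 = - (y / (1 + y))" using y by (simp add: field_simps)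
        ultimately show ?thesis using y by (simp add: ln_div)
      qed
      finally have "b * n * (y / (1 + y0)) \<le> b * n * ln (1 + y)"
        using b by (intro mult_left_mono) auto
      moreover have "m * (k' * L) \<le> b * n * (y / (1 + y0))"
      proof -
        have "m * (k' * L) \<le> m * (k' * (n * c n))"
          using L(2) b y0 by (intro mult_left_mono) (auto simp: k'_def)
        then show ?thesis by (simp add: k'_def y_def mult_ac)
      qed
      ultimately have e: "exp (- (b * n) * ln (1 + y)) \<le> exp (- (m * (k' * L)))" by simp
      have "real (n choose m) * exp (- (b * n) * ln (1 + y)) \<le> real n ^ m * exp (- (m * (k' * L)))"
        using e by (intro mult_mono binomial_le_power) auto
      also have "\<dots> = (real n * exp (- (k' * L))) ^ m"
        by (simp add: power_mult_distrib flip: exp_of_nat_mult)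
      also have "real n * exp (- (k' * L)) = exp (ln n - k' * L)"
        using n(1) by (simp add: exp_diff exp_minus field_simps)
      also have "ln n - k' * L = - (k * ln n - k')"
      proof -
        have "k = k' / \<alpha> - 1" by (simp add: k_def k'_def mult.commute)
        then show ?thesis unfolding L_def by (simp only:) (simp add: algebra_simps)
      qed
      also have "exp \<dots> ^ m = q n ^ m" by (simp add: q_def)
      finally have "real (n choose m) * exp (- (b * n) * ln (1 + y)) \<le> q n ^ m" .
      then show ?thesis by (simp add: y_def add_increasing2)
    next
      case 2
      \<comment> \<open>Bounded \<open>y\<close> forces \<open>m\<close> to be of order at most
        \<open>n / L\<close>, hence \<open>n / ln n\<close>.\<close>
      have "m * L \<le> m * (n * c n)" using L by (intro mult_left_mono) auto
      also have "\<dots> = n * y" by (simp add: y_def)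
      also have "\<dots> \<le> n * y1" using 2 by (intro mult_left_mono) auto
      finally have "m \<le> n * y1 / L" using L by (simp add: field_simps)
      then have "m * (- ln z) \<le> n * y1 / L * (- ln z)" using lz by (intro mult_right_mono) auto
      also have "\<dots> = n * (y1 * (- ln z) / L)" by simp
      also have "\<dots> \<le> n * (w0 / 4)" using n(4) by (intro mult_left_mono) (auto simp: L_def)
      finally have 3: "- m * ln z \<le> n * (w0 / 4)" by simp
      have 4: "z * n \<le> (w0 / 4) * n" using z by (intro mult_right_mono) auto
      have "ln (1 + y0) \<le> ln (1 + y)" using 2 y0 by simp
      then have 5: "n * w0 \<le> b * n * ln (1 + y)" unfolding w0_def using b
        by (simp add: mult_left_mono mult.left_commute mult.assoc)
      have "real (n choose m) * exp (- (b * n) * ln (1 + y)) \<le> exp (z * n - m * ln z) * exp (- (b * n) * ln (1 + y))"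
        using m z(1) by (intro mult_right_mono binomial_le_exp) auto
      also have "\<dots> = exp (z * n - m * ln z - b * n * ln (1 + y))"
        by (simp flip: exp_add)
      also have "\<dots> \<le> exp (- (w0 / 2) * n)"
        using 3 4 5 by (simp add: algebra_simps)
      also have "\<dots> \<le> exp (- w * n)"
        using mult_right_mono[of w "w0 / 2" n] by (simp add: w_def)
      finally show ?thesis by (simp add: y_def q_def add_increasing)
    next
      case 3
      have "(ln 2 + 1) / b = ln y1" by (simp add: y1_def)
      also have "\<dots> \<le> ln (1 + y)"
        using 3 y by (intro ln_mono) (auto simp: y1_def)
      finally have "ln 2 + 1 \<le> b * ln (1 + y)" using b by (simp add: field_simps)
      then have "n * (ln 2 + 1) \<le> n * (b * ln (1 + y))" by (intro mult_left_mono) auto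
      then have e: "- (b * n) * ln (1 + y) \<le> - n * ln 2 - n" by (simp add: algebra_simps)
      have "real (n choose m) \<le> 2 ^ n"
        using binomial_le_pow2[of n m] by (metis of_nat_le_iff of_nat_numeral of_nat_power)
      then have "real (n choose m) * exp (- (b * n) * ln (1 + y)) \<le> 2 ^ n * exp (- n * ln 2 - n)"
        using e by (intro mult_mono) auto
      also have "(2::real) ^ n = exp (n * ln 2)" by (simp add: exp_of_nat_mult)
      also have "\<dots> * exp (- n * ln 2 - n) = exp (- 1 * n)" by (simp flip: exp_add)
      also have "\<dots> \<le> exp (- w * n)"
        using mult_right_mono[of w 1 n] by (simp add: w_def)
      finally show ?thesis by (simp add: y_def q_def add_increasing)
    qed
  qed
  \<comment> \<open>The terms \<open>q n ^ m\<close> form a geometric series starting at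
    \<open>m = 1\<close>, at most \<open>2 * q n\<close> once \<open>q n < 1 / 2\<close>.\<close>
  have upper: "\<forall>\<^sub>F n in sequentially. (\<Sum>m\<in>{1..n}. real (n choose m) * exp (- (b * n) * ln (1 + m * c n)))
    \<le> 2 * q n + n * exp (- w * n)"
    using ev c
  proof eventually_elim
    case (elim n)
    have q: "0 < q n" "q n < 1 / 2" using elim by (auto simp: q_def)
    have "(\<Sum>m\<in>{1..n}. real (n choose m) * exp (- (b * n) * ln (1 + m * c n))) \<le>
      (\<Sum>m\<in>{1..n}. q n ^ m + exp (- w * n))"
      using elim by (intro sum_mono summand) auto
    also have "\<dots> = (\<Sum>m\<in>{1..n}. q n ^ m) + n * exp (- w * n)"
      by (simp add: sum.distrib)
    also have "(\<Sum>m\<in>{1..n}. q n ^ m) \<le> 2 * q n"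
    proof -
      have "(\<Sum>m\<in>{1..n}. q n ^ m) = (\<Sum>m<n. q n ^ Suc m)"
        by (simp add: sum.atLeast1_atMost_eq)
      also have "\<dots> = q n * (\<Sum>m<n. q n ^ m)" by (simp add: sum_distrib_left)
      also have "\<dots> = q n * ((1 - q n ^ n) / (1 - q n))"
        using q by (simp add: sum_gp_strict)
      also have "(1 - q n ^ n) / (1 - q n) \<le> 1 / (1 / 2)"
        using q by (intro frac_le) auto
      finally show ?thesis using q by (simp add: mult_left_mono)
    qed
    finally show ?case by simp
  qed
  have "(\<lambda>n. 2 * q n + n * exp (- w * n)) \<longlonglongrightarrow> 0"
    unfolding q_def using k w by real_asymp
  then show ?thesis
    by (rule tendsto_sandwich[OF _ upper tendsto_const, rotated])
      (use c ev(2) in eventually_elim, auto intro!: sum_nonneg)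
qed

subsection \<open>The phase transition\<close>

text \<open>A finite bound on the sum excludes infinite \<open>H v\<close>. The summand
  \<open>1\<close> counts the additional particle of the root.\<close>

lemma particles_finite_card:
  assumes n: "n > 0" and le: "(\<Sum>v<n. ennreal_of_enat (H v)) \<le> ennreal x" and x: "0 \<le> x"
  shows "finite (particles n H)" "real (card (particles n H)) \<le> x + 1"
proof -
  define h where "h v = the_enat (H v)" for v
  have h: "H v = enat (h v)" if "v < n" for v
  proof -
    have "ennreal_of_enat (H v) \<le> (\<Sum>v<n. ennreal_of_enat (H v))"
      using that by (intro member_le_sum) auto
    also note le
    finally have "ennreal_of_enat (H v) < top" using ennreal_less_top le_less_trans by blast
    then have "H v \<noteq> \<infinity>" by (metis ennreal_of_enat_infty order_less_irrefl infinity_ennreal_def)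
    then show ?thesis by (cases "H v") (auto simp: h_def)
  qed
  have "(\<Sum>v<n. ennreal_of_enat (H v)) = (\<Sum>v<n. ennreal (real (h v)))"
    using h by (intro sum.cong) (auto simp: ennreal_of_enat_enat ennreal_of_nat_eq_real_of_nat)
  then have hx: "(\<Sum>v<n. real (h v)) \<le> x"
    using le x by (simp add: sum_ennreal)
  have eq: "particles n H = Sigma {..<n} (\<lambda>v. {..<(if v = 0 then 1 else 0) + h v})"
    using h by (auto simp: particles_def one_enat_def zero_enat_def split: if_splits)
  then show "finite (particles n H)" by simp
  have "card (particles n H) = (\<Sum>v<n. (if v = 0 then 1 else 0) + h v)"
    unfolding eq by simp
  also have "\<dots> = 1 + (\<Sum>v<n. h v)"
    using n by (simp add: sum.distrib)
  finally show "real (card (particles n H)) \<le> x + 1"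
    using hx by simp
qed

lemma frog_cover_prob_eq:
  assumes "pmf eta \<infinity> = 0" "p \<noteq> 1"
  shows "frog_cover_prob n p eta = measure (iid_pmf eta \<Otimes>\<^sub>M steps n p) {\<omega>. frog_V n (fst \<omega>) (snd \<omega>) = n}"
  using assms by (simp add: frog_cover_prob_def frog_space_eq space_pair_measure)

lemma frog_not_cover_prob_eq:
  assumes "pmf eta \<infinity> = 0" "p \<noteq> 1"
  shows "1 - frog_cover_prob n p eta = measure (iid_pmf eta \<Otimes>\<^sub>M steps n p) {\<omega>. frog_V n (fst \<omega>) (snd \<omega>) \<noteq> n}"
proof -
  interpret M: prob_space "iid_pmf eta :: (nat \<Rightarrow> enat) measure" by (rule prob_space_iid_pmf)
  interpret N: prob_space "steps n p" by (rule prob_space_iid_pmf)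
  interpret P: pair_prob_space "iid_pmf eta :: (nat \<Rightarrow> enat) measure" "steps n p" ..
  have "{\<omega>. frog_V n (fst \<omega>) (snd \<omega>) \<noteq> n} =
    space (iid_pmf eta \<Otimes>\<^sub>M steps n p) - {\<omega>. frog_V n (fst \<omega>) (snd \<omega>) = n}"
    by (auto simp: space_pair_measure)
  then show ?thesis
    using P.prob_compl[OF measurable_frog_covered, of n] frog_cover_prob_eq[OF assms] by simp
qed

lemma frog_uncovered_sets:
  "{\<omega>. frog_V n (fst \<omega>) (snd \<omega>) \<noteq> n} \<in> sets (iid_pmf eta \<Otimes>\<^sub>M iid_pmf q)"
proof -
  have "{\<omega>. frog_V n (fst \<omega>) (snd \<omega>) \<noteq> n} =
    space (iid_pmf eta \<Otimes>\<^sub>M iid_pmf q) - {\<omega>. frog_V n (fst \<omega>) (snd \<omega>) = n}"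
    by (auto simp: space_pair_measure)
  then show ?thesis using measurable_frog_covered by simp
qed

text \<open>Evaluates the rate \<open>p / ((1 - p) * (n - 1))\<close> at
  \<open>p = 1 - \<alpha> / ln n\<close>; here \<open>l\<close>, \<open>a\<close>, \<open>x\<close>
  stand for \<open>ln n\<close>, \<open>\<alpha>\<close>, \<open>n - 1\<close>.\<close>

lemma step_rate_eq:
  fixes l a x :: real
  assumes "0 < l" "0 < a"
  shows "(1 - a / l) / ((1 - (1 - a / l)) * x) = (l / a - 1) / x"
proof -
  have "(1 - a / l) / (1 - (1 - a / l)) = l / a - 1"
    using assms by (simp add: field_simps)
  then show ?thesis by (metis divide_divide_eq_left)
qed

text \<open>With \<open>\<beta>\<close> strictly between the mean and \<open>\<alpha>\<close>,
  \<open>c n * N n\<close> is eventually below \<open>k * ln n\<close> for some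
  \<open>k < 1\<close>, so the expected number of missed vertices diverges, while
  \<open>(c n)\<^sup>2 * N n\<close> tends to \<open>0\<close>.\<close>

lemma frog_cover_prob_tendsto_0:
  assumes \<alpha>: "\<alpha> > 0" and less: "frog_expect eta < ennreal \<alpha>"
  shows "(\<lambda>n. frog_cover_prob n (max 0 (1 - \<alpha> / ln (real n))) eta) \<longlonglongrightarrow> 0"
proof -
  obtain \<mu> where \<mu>: "frog_expect eta = ennreal \<mu>" "0 \<le> \<mu>"
    using less by (cases "frog_expect eta") auto
  then have "\<mu> < \<alpha>" using less by (simp add: ennreal_less_iff)
  then obtain \<beta> where \<beta>: "\<mu> < \<beta>" "\<beta> < \<alpha>" using dense by blast
  then have \<beta>0: "0 < \<beta>" using \<mu> by simp
  \<comment> \<open>A finite mean rules out the value infinity, so the convention in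
    \<open>frog_cover_prob\<close> for that case does not apply.\<close>
  have inf: "pmf eta \<infinity> = 0"
  proof -
    have "AE x in measure_pmf eta. ennreal_of_enat x \<noteq> \<infinity>"
      using \<mu> by (intro nn_integral_PInf_AE) (auto simp: frog_expect_def)
    then have "\<infinity> \<notin> set_pmf eta" by (auto simp: AE_measure_pmf_iff)
    then show ?thesis by (simp add: set_pmf_iff)
  qed
  define c where "c n = (ln (real n) / \<alpha> - 1) / (real n - 1)" for n
  define N where "N n = real n * \<beta> + 1" for n
  define \<delta> where "\<delta> n = 1 / ((real n - 1) * exp (- c n * N n)) + (exp ((c n)\<^sup>2 * N n) - 1)" for n
  define bad where "bad n = {H. (\<Sum>v<n. ennreal_of_enat (H v)) > ennreal (real n * \<beta>)}" for n
  have \<delta>: "\<delta> \<longlonglongrightarrow> 0"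
  proof -
    have "(\<lambda>n. 1 / ((real n - 1) * exp (- c n * N n))) \<longlonglongrightarrow> 0"
    proof -
      have "\<beta> / \<alpha> < 1" using \<beta> \<alpha> by simp
      then obtain k where k: "\<beta> / \<alpha> < k" "k < 1" using dense by blast
      have "(\<lambda>n. c n * N n / ln (real n)) \<longlonglongrightarrow> inverse \<alpha> * \<beta>"
        unfolding c_def N_def using \<alpha> \<beta> \<beta>0 by real_asymp
      then have "\<forall>\<^sub>F n in sequentially. c n * N n / ln (real n) < k"
        by (rule order_tendstoD(2)) (use k in \<open>simp add: divide_inverse mult.commute\<close>)
      then have upper: "\<forall>\<^sub>F n in sequentially. 1 / ((real n - 1) * exp (- c n * N n)) \<le>
          1 / ((real n - 1) * exp (- (k * ln (real n))))"
        using eventually_ge_at_top[of 2]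
      proof eventually_elim
        case (elim n)
        then have "c n * N n \<le> k * ln (real n)" by (simp add: field_simps)
        then show ?case using elim by (intro divide_left_mono mult_left_mono mult_pos_pos) auto
      qed
      have lower: "\<forall>\<^sub>F n in sequentially. 0 \<le> 1 / ((real n - 1) * exp (- c n * N n))"
        using eventually_ge_at_top[of 1] by eventually_elim simp
      have "(\<lambda>n. 1 / ((real n - 1) * exp (- (k * ln (real n))))) \<longlonglongrightarrow> 0"
        using k by real_asymp
      then show ?thesis by (rule tendsto_sandwich[OF lower upper tendsto_const])
    qed
    moreover have "(\<lambda>n. exp ((c n)\<^sup>2 * N n) - 1) \<longlonglongrightarrow> 0"
      unfolding c_def N_def using \<alpha> \<beta> \<beta>0 by real_asymp
    ultimately show ?thesis unfolding \<delta>_def by (rule tendsto_add_zero)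
  qed
  have "\<forall>\<^sub>F n in sequentially. ln (real n) > \<alpha>" by real_asymp
  then have "\<forall>\<^sub>F n in sequentially. ln (real n) > \<alpha> \<and> n \<ge> 2"
    by (intro eventually_conj eventually_ge_at_top)
  then have upper: "\<forall>\<^sub>F n in sequentially. frog_cover_prob n (max 0 (1 - \<alpha> / ln (real n))) eta \<le>
     measure (iid_pmf eta) (bad n) + \<delta> n"
  proof eventually_elim
    case (elim n)
    define p where "p = 1 - \<alpha> / ln (real n)"
    have ln: "ln (real n) > 0" using elim \<alpha> by linarith
    then have p: "0 \<le> p" "p < 1" using elim \<alpha> by (auto simp: p_def)
    have max_p: "max 0 (1 - \<alpha> / ln (real n)) = p" using p by (simp add: p_def)
    have c: "p / ((1 - p) * (real n - 1)) = c n"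
      using step_rate_eq[OF ln \<alpha>] by (simp add: p_def c_def)
    have c0: "0 \<le> c n" using elim \<alpha> by (simp add: c_def)
    have N0: "0 \<le> N n" using \<beta>0 by (simp add: N_def)
    have "measure (iid_pmf eta \<Otimes>\<^sub>M steps n p) {\<omega>. frog_V n (fst \<omega>) (snd \<omega>) = n} \<le>
       measure (iid_pmf eta) (bad n) + \<delta> n"
    proof (rule prob_pair_le)
      have "Measurable.pred (iid_pmf eta) (\<lambda>H. (\<Sum>v<n. ennreal_of_enat (H v)) > ennreal (real n * \<beta>))"
        by measurable
      then show "bad n \<in> sets (iid_pmf eta)" by (simp add: bad_def pred_def)
      show "0 \<le> \<delta> n"
        using elim N0 by (simp add: \<delta>_def)
      fix H assume "H \<in> space (iid_pmf eta) - bad n"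
      then have "(\<Sum>v<n. ennreal_of_enat (H v)) \<le> ennreal (real n * \<beta>)"
        by (simp add: bad_def not_less)
      then have "finite (particles n H)" "real (card (particles n H)) \<le> N n"
        using particles_finite_card[of n H "real n * \<beta>"] elim \<beta>0 by (auto simp: N_def)
      then show "measure (steps n p) (Pair H -` {\<omega>. frog_V n (fst \<omega>) (snd \<omega>) = n}) \<le> \<delta> n"
        using quenched_not_covered[of n p H "N n"] elim p by (simp add: c \<delta>_def vimage_def)
    qed (rule prob_space_iid_pmf measurable_frog_covered)+
    then show ?case
      unfolding max_p frog_cover_prob_eq[OF inf less_imp_neq[OF p(2)]] .
  qed
  have "(\<lambda>n. measure (iid_pmf eta) (bad n) + \<delta> n) \<longlonglongrightarrow> 0"
    unfolding bad_def using \<beta> \<mu> \<delta>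
    by (intro tendsto_add_zero weak_law_upper) (auto simp: ennreal_less_iff)
  then show ?thesis
    by (rule tendsto_sandwich[OF _ upper tendsto_const, rotated])
      (auto simp: frog_cover_prob_def)
qed

text \<open>If infinity has positive mass, the claim holds by convention. Otherwise the failure
  probability is bounded by three vanishing terms: Hoeffding's bound for the initial configuration,
  the exploration and the union bound.\<close>

lemma frog_cover_prob_tendsto_1:
  assumes \<alpha>: "\<alpha> > 0" and less: "ennreal \<alpha> < frog_expect eta"
  shows "(\<lambda>n. frog_cover_prob n (max 0 (1 - \<alpha> / ln (real n))) eta) \<longlonglongrightarrow> 1"
proof (cases "pmf eta \<infinity> = 0")
  case False
  then have "pmf eta \<infinity> > 0" by (simp add: pmf_pos)
  then show ?thesis by (simp add: frog_cover_prob_def)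
next
  case inf: True
  obtain K where K: "\<alpha> < measure_pmf.expectation eta (\<lambda>x. real (trunc K x))"
    using less \<alpha> unfolding frog_expect_SUP_trunc less_SUP_iff by (auto simp: ennreal_less_iff)
  define m where "m = measure_pmf.expectation eta (\<lambda>x. real (trunc K x))"
  have K0: "K > 0"
  proof (rule ccontr)
    assume "\<not> K > 0"
    then have "trunc K x = 0" for x using trunc_le(1)[of K x] by simp
    then show False using K \<alpha> by simp
  qed
  \<comment> \<open>The gap is split in three: one \<open>\<epsilon>\<close> for fluctuations, one
    for particles at unvisited vertices, and one left over, since
    \<open>b = \<alpha> + \<epsilon>\<close>.\<close>
  define \<epsilon> where "\<epsilon> = (m - \<alpha>) / 3"
  have \<epsilon>: "\<epsilon> > 0" using K by (simp add: \<epsilon>_def m_def)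
  define b where "b = m - 2 * \<epsilon>"
  have b: "\<alpha> < b" using \<epsilon> by (simp add: b_def \<epsilon>_def field_simps)
  define d where "d = \<epsilon> / (2 * K)"
  have d: "d > 0" using \<epsilon> K0 by (simp add: d_def)
  define c where "c n = (ln (real n) / \<alpha> - 1) / (real n - 1)" for n
  \<comment> \<open>Small enough that \<open>K * M n \<le> \<epsilon> * n\<close>, yet linear in
    \<open>n\<close>, so that the exploration error tends to \<open>0\<close>.\<close>
  define M where "M n = nat \<lfloor>(\<epsilon> / K) * real n\<rfloor>" for n
  \<comment> \<open>The \<open>3 / 2\<close> absorbs the rounding in the floor and in
    \<open>M n div 2\<close>.\<close>
  define u where "u n = 1 / (1 + (d * real n - 3 / 2) * c n)" for n
  define s where "s n = (\<Sum>j\<in>{1..n}. real (n choose j) * exp (- (b * n) * ln (1 + j * c n)))" for n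
  define bad where "bad n = {H. (\<Sum>v<n. real (trunc K (H v))) \<le> real n * (m - \<epsilon>)}" for n
  have evs: "\<forall>\<^sub>F n in sequentially. ln (real n) > \<alpha>" "\<forall>\<^sub>F n in sequentially. d * real n - 3 / 2 > 0"
    using d by real_asymp+
  have u: "u \<longlonglongrightarrow> 0" unfolding u_def c_def using d \<alpha> by real_asymp
  have s: "s \<longlonglongrightarrow> 0"
    unfolding s_def
  proof (rule binomial_sum_tendsto_0[OF \<alpha> b])
    show "\<forall>\<^sub>F n in sequentially. ln (real n) / \<alpha> - 1 \<le> real n * c n"
      using evs(1) eventually_ge_at_top[of 2]
    proof eventually_elim
      case (elim n)
      have "(ln (real n) / \<alpha> - 1) * 1 \<le> (ln (real n) / \<alpha> - 1) * (real n / (real n - 1))"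
        using elim \<alpha> by (intro mult_left_mono) (auto simp: field_simps)
      then show ?case by (simp add: c_def mult.commute)
    qed
  qed
  have "\<forall>\<^sub>F n in sequentially. u n < 1 / 8" by (rule order_tendstoD(2)[OF u]) simp
  with evs have upper: "\<forall>\<^sub>F n in sequentially. 1 - frog_cover_prob n (max 0 (1 - \<alpha> / ln (real n))) eta \<le>
     exp (- 2 * \<epsilon>\<^sup>2 / (real K)\<^sup>2 * n) + (2 * u n + s n)"
    using eventually_ge_at_top[of 2]
  proof eventually_elim
    case (elim n)
    define p where "p = 1 - \<alpha> / ln (real n)"
    have ln: "ln (real n) > 0" using elim \<alpha> by linarith
    then have p: "0 \<le> p" "p < 1" using elim \<alpha> by (auto simp: p_def)
    have max_p: "max 0 (1 - \<alpha> / ln (real n)) = p" using p by (simp add: p_def)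
    have c: "p / ((1 - p) * (real n - 1)) = c n"
      using step_rate_eq[OF ln \<alpha>] by (simp add: p_def c_def)
    have c0: "0 \<le> c n" using elim \<alpha> by (simp add: c_def)
    have Mu: "1 / (1 + real (M n div 2) * c n) \<le> u n"
    proof -
      have "(\<epsilon> / K) * n - 1 \<le> M n" unfolding M_def using \<epsilon> by linarith
      moreover have "real (M n) \<le> 2 * real (M n div 2) + 1" by linarith
      moreover have "d * real n = (\<epsilon> / K) * n / 2" by (simp add: d_def)
      moreover have "x / 2 - 3 / 2 \<le> h" if "x - 1 \<le> y" "y \<le> 2 * h + 1" for x y h :: real
        using that by linarith
      ultimately have "d * real n - 3 / 2 \<le> real (M n div 2)" by metis
      then have "(d * real n - 3 / 2) * c n \<le> real (M n div 2) * c n"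
        using c0 by (rule mult_right_mono)
      moreover have "0 \<le> (d * real n - 3 / 2) * c n" using elim c0 by simp
      ultimately show ?thesis unfolding u_def by (intro divide_left_mono) (auto intro!: mult_pos_pos add_pos_nonneg)
    qed
    have s0: "0 \<le> s n" unfolding s_def by (intro sum_nonneg) auto
    have u0: "0 \<le> u n" using elim c0 by (simp add: u_def)
    have "measure (iid_pmf eta \<Otimes>\<^sub>M steps n p) {\<omega>. frog_V n (fst \<omega>) (snd \<omega>) \<noteq> n} \<le>
       measure (iid_pmf eta) (bad n) + (2 * u n + s n)"
    proof (rule prob_pair_le)
      have "Measurable.pred (iid_pmf eta) (\<lambda>H. (\<Sum>v<n. real (trunc K (H v))) \<le> real n * (m - \<epsilon>))"
        by measurable
      then show "bad n \<in> sets (iid_pmf eta)" by (simp add: bad_def pred_def)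
      show "0 \<le> 2 * u n + s n" using u0 s0 by simp
      fix H assume "H \<in> space (iid_pmf eta) - bad n"
      then have H: "n * (m - \<epsilon>) \<le> (\<Sum>v<n. real (trunc K (H v)))" by (simp add: bad_def)
      have "real (M n) \<le> (\<epsilon> / K) * n" unfolding M_def using \<epsilon> by simp
      then have "real K * M n \<le> \<epsilon> * n" using K0 by (simp add: field_simps)
      then have "real K * M n + b * n \<le> (\<Sum>v<n. trunc K (H v))"
        using H by (simp add: b_def algebra_simps)
      then have "\<exists>E \<in> sets (steps n p). {S. frog_V n H S \<noteq> n} \<subseteq> E \<and> measure (steps n p) E \<le>
         2 / (1 + real (M n div 2) * (p / ((1 - p) * (real n - 1)))) +
         (\<Sum>j\<in>{1..n}. real (n choose j) * exp (- (b * n) * ln (1 + j * (p / ((1 - p) * (real n - 1))))))"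
        using elim p b \<alpha> Mu trunc_le by (intro quenched_covered) (auto simp: c)
      then obtain E where E: "E \<in> sets (steps n p)" "{S. frog_V n H S \<noteq> n} \<subseteq> E"
        "measure (steps n p) E \<le> 2 * (1 / (1 + real (M n div 2) * c n)) + s n"
        by (auto simp: c s_def)
      have "measure (steps n p) (Pair H -` {\<omega>. frog_V n (fst \<omega>) (snd \<omega>) \<noteq> n}) \<le> measure (steps n p) E"
        using E by (intro finite_measure.finite_measure_mono prob_space.finite_measure prob_space_iid_pmf) auto
      also have "\<dots> \<le> 2 * u n + s n"
        using E(3) mult_left_mono[OF Mu, of 2] by linarith
      finally show "measure (steps n p) (Pair H -` {\<omega>. frog_V n (fst \<omega>) (snd \<omega>) \<noteq> n}) \<le> 2 * u n + s n" .
    qed (rule prob_space_iid_pmf frog_uncovered_sets)+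
    moreover have "measure (iid_pmf eta) (bad n) \<le> exp (- 2 * \<epsilon>\<^sup>2 / (real K)\<^sup>2 * n)"
      unfolding bad_def m_def using K0 \<epsilon> elim by (intro iid_pmf_Hoeffding) (auto simp: trunc_le)
    ultimately show ?case
      unfolding max_p frog_not_cover_prob_eq[OF inf less_imp_neq[OF p(2)]] by linarith
  qed
  have "(\<lambda>n. exp (- 2 * \<epsilon>\<^sup>2 / (real K)\<^sup>2 * n)) \<longlonglongrightarrow> 0"
  proof -
    have "(\<lambda>n. exp (- (2 * \<epsilon>\<^sup>2 / (real K)\<^sup>2) * real n)) \<longlonglongrightarrow> 0"
      using K0 \<epsilon> by (intro exp_neg_mult_tendsto_0) simp
    then show ?thesis by simp
  qed
  then have lim: "(\<lambda>n. exp (- 2 * \<epsilon>\<^sup>2 / (real K)\<^sup>2 * n) + (2 * u n + s n)) \<longlonglongrightarrow> 0"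
    using u s by (intro tendsto_add_zero tendsto_mult_right_zero)
  have "(\<lambda>n. 1 - frog_cover_prob n (max 0 (1 - \<alpha> / ln (real n))) eta) \<longlonglongrightarrow> 0"
  proof (rule tendsto_sandwich[OF _ upper tendsto_const lim])
    have "frog_cover_prob n p eta \<le> 1" for n p
    proof -
      interpret M: prob_space "iid_pmf eta :: (nat \<Rightarrow> enat) measure" by (rule prob_space_iid_pmf)
      interpret N: prob_space "steps n p" by (rule prob_space_iid_pmf)
      interpret P: pair_prob_space "iid_pmf eta :: (nat \<Rightarrow> enat) measure" "steps n p" ..
      show ?thesis by (simp add: frog_cover_prob_def frog_space_eq)
    qed
    then show "\<forall>\<^sub>F n in sequentially. 0 \<le> 1 - frog_cover_prob n (max 0 (1 - \<alpha> / ln (real n))) eta" by simp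
  qed
  from tendsto_diff[OF tendsto_const[of 1] this] show ?thesis by simp
qed

theorem theorem1p2:
  fixes eta :: "enat pmf" and \<alpha> :: real
  assumes "pmf eta 0 < 1" and "\<alpha> > 0"
  shows "(ennreal \<alpha> > frog_expect eta \<longrightarrow>
            (\<lambda>n. frog_cover_prob n (max 0 (1 - \<alpha> / ln (real n))) eta) \<longlonglongrightarrow> 0)
       \<and> (ennreal \<alpha> < frog_expect eta \<longrightarrow>
            (\<lambda>n. frog_cover_prob n (max 0 (1 - \<alpha> / ln (real n))) eta) \<longlonglongrightarrow> 1)"
  using frog_cover_prob_tendsto_0 frog_cover_prob_tendsto_1 assms(2) by blast

end
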